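(* Let $n\ge3$, $\hbar>0$, $q=e^{i\pi\hbar}$, and let $\mathcal A$ be the quantum monodromy algebra with generators $a_i,b_i,c_i$, $i=1,\dots,n-1$ (defined in the context), with $M_i=\begin{pmatrix}qa_i&-b_i\\c_i&-q^{-1}a_i\end{pmatrix}$. For $i=1,\dots,n-2$, the transformation $$\beta_{i,i+1}[M_j]=\begin{cases}M_j,& j\ne i,i+1,\\ M_i,& j=i+1,\\ -M_iM_{i+1}M_i,& j=i\end{cases}$$ (with operators ordered by the order of matrix multiplication) is an automorphism of the quantum algebra $\mathcal A$. These automorphisms satisfy the braid-group identities $$\beta_{i,i+1}\beta_{i+1,i+2}\beta_{i,i+1}=\beta_{i+1,i+2}\beta_{i,i+1}\beta_{i+1,i+2},\qquad i=1,\dots,n-3 .$$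
   Context: $\mathcal A$ is the associative unital $\mathbb C$-algebra with generators $a_i,b_i,c_i$, $i=1,\dots,n-1$, and relations: for each $i$, $$qa_ib_i=q^{-1}b_ia_i,\quad q^{-1}a_ic_i=qc_ia_i,\quad b_ic_i-c_ib_i=(q^2-q^{-2})a_i^2,\quad b_ic_i=q^2a_i^2+1,$$ and for all $i<j$, \begin{align*} & q^{-1}b_ib_j=qb_jb_i,\quad q^{-1}c_ic_j=qc_jc_i,\quad a_ib_j=b_ja_i,\quad c_ia_j=a_jc_i,\quad qc_ib_j=q^{-1}b_jc_i,\\ & b_ia_j=a_jb_i+(q^2-q^{-2})a_ib_j,\quad a_ic_j=c_ja_i+(q^2-q^{-2})c_ia_j,\\ & a_ia_j=a_ja_i+(1-q^{-2})b_jc_i=a_ja_i+(q^2-1)c_ib_j,\\ & qb_ic_j+q(q^{-2}-q^{2})a_ia_j=q^{-1}c_jb_i-q^{-1}(q^{-2}-q^{2})a_ja_i . \end{align*} In particular $M_i^2=-\mathbb E$. A transformation given on the matrices $M_j$ is understood as given on the generators by reading off the entries of the image matrices, which are again of the form $\begin{pmatrix}qa'_j&-b'_j\\c'_j&-q^{-1}a'_j\end{pmatrix}$. *)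

theory Defs
  imports Complex_Main "HOL-Library.Poly_Mapping" "HOL-Library.FuncSet" "HOL-Algebra.QuotRing"
begin

datatype gen = Gen_a nat | Gen_b nat | Gen_c nat

text \<open>Words form the free monoid, written additively so that finitely supported functions
  on words carry the convolution product of \<^theory>\<open>HOL-Library.Poly_Mapping\<close>; with complex
  coefficients they are the noncommutative polynomials.\<close>

datatype word = Word (letters: "gen list")

instantiation word :: monoid_add
begin

definition zero_word :: word where
  "0 = Word []"

definition plus_word :: "word \<Rightarrow> word \<Rightarrow> word" where
  "v + w = Word (letters v @ letters w)"

instance
  by standard (simp_all add: zero_word_def plus_word_def)

end

type_synonym ncpoly = "word \<Rightarrow>\<^sub>0 complex"

definition const :: "complex \<Rightarrow> ncpoly" where
  "const c = Poly_Mapping.single 0 c"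

definition var :: "gen \<Rightarrow> ncpoly" where
  "var g = Poly_Mapping.single (Word [g]) 1"

definition gens :: "nat \<Rightarrow> gen set" where
  "gens n = (\<Union>i\<in>{1..n - 1}. {Gen_a i, Gen_b i, Gen_c i})"

definition free_algebra :: "nat \<Rightarrow> ncpoly ring" where
  "free_algebra n =
    \<lparr>carrier = {p. \<forall>w\<in>Poly_Mapping.keys p. set (letters w) \<subseteq> gens n},
     mult = (*), one = 1, zero = 0, add = (+)\<rparr>"

text \<open>Each defining relation \<open>l = r\<close> is represented by the element \<open>l - r\<close>.\<close>

definition relators :: "nat \<Rightarrow> complex \<Rightarrow> ncpoly set" where
  "relators n q =
    (let a = \<lambda>i. var (Gen_a i); b = \<lambda>i. var (Gen_b i); c = \<lambda>i. var (Gen_c i) in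
     (\<Union>i\<in>{1..n - 1}.
        {const q * a i * b i - const (1 / q) * b i * a i,
         const (1 / q) * a i * c i - const q * c i * a i,
         (b i * c i - c i * b i) - const (q\<^sup>2 - 1 / q\<^sup>2) * (a i)\<^sup>2,
         b i * c i - (const (q\<^sup>2) * (a i)\<^sup>2 + 1)}) \<union>
     (\<Union>i\<in>{1..n - 1}. \<Union>j\<in>{i<..n - 1}.
        {const (1 / q) * b i * b j - const q * b j * b i,
         const (1 / q) * c i * c j - const q * c j * c i,
         a i * b j - b j * a i,
         c i * a j - a j * c i,
         const q * c i * b j - const (1 / q) * b j * c i,
         b i * a j - (a j * b i + const (q\<^sup>2 - 1 / q\<^sup>2) * a i * b j),
         a i * c j - (c j * a i + const (q\<^sup>2 - 1 / q\<^sup>2) * c i * a j),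
         a i * a j - (a j * a i + const (1 - 1 / q\<^sup>2) * b j * c i),
         a i * a j - (a j * a i + const (q\<^sup>2 - 1) * c i * b j),
         (const q * b i * c j + const (q * (1 / q\<^sup>2 - q\<^sup>2)) * a i * a j)
           - (const (1 / q) * c j * b i - const (1 / q * (1 / q\<^sup>2 - q\<^sup>2)) * a j * a i)}))"

text \<open>Ideals in \<^theory>\<open>HOL-Algebra.Ideal\<close> are two-sided, so this is the ideal generated by the
  relations of a noncommutative presentation.\<close>

definition rel_ideal :: "nat \<Rightarrow> complex \<Rightarrow> ncpoly set" where
  "rel_ideal n q = Idl\<^bsub>free_algebra n\<^esub> (relators n q)"

definition qalg :: "nat \<Rightarrow> complex \<Rightarrow> ncpoly set ring" where
  "qalg n q = free_algebra n Quot rel_ideal n q"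

definition cls :: "nat \<Rightarrow> complex \<Rightarrow> ncpoly \<Rightarrow> ncpoly set" where
  "cls n q p = rel_ideal n q +>\<^bsub>free_algebra n\<^esub> p"

definition scale :: "nat \<Rightarrow> complex \<Rightarrow> complex \<Rightarrow> ncpoly set \<Rightarrow> ncpoly set" where
  "scale n q c x = cls n q (const c) \<otimes>\<^bsub>qalg n q\<^esub> x"

definition alg_end :: "nat \<Rightarrow> complex \<Rightarrow> (ncpoly set \<Rightarrow> ncpoly set) set" where
  "alg_end n q =
    {f \<in> ring_hom (qalg n q) (qalg n q).
       \<forall>c. \<forall>x\<in>carrier (qalg n q). f (scale n q c x) = scale n q c (f x)}"

definition alg_aut :: "nat \<Rightarrow> complex \<Rightarrow> (ncpoly set \<Rightarrow> ncpoly set) set" where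
  "alg_aut n q =
    {f \<in> alg_end n q. bij_betw f (carrier (qalg n q)) (carrier (qalg n q))}"

text \<open>\<open>Mat2 x y z w\<close> has first row \<open>x, y\<close> and second row \<open>z, w\<close>.\<close>

datatype 'a mat2 = Mat2 'a 'a 'a 'a

fun mat2_mult :: "('a, 'm) ring_scheme \<Rightarrow> 'a mat2 \<Rightarrow> 'a mat2 \<Rightarrow> 'a mat2" where
  "mat2_mult R (Mat2 x y z w) (Mat2 x' y' z' w') =
    Mat2 (x \<otimes>\<^bsub>R\<^esub> x' \<oplus>\<^bsub>R\<^esub> y \<otimes>\<^bsub>R\<^esub> z') (x \<otimes>\<^bsub>R\<^esub> y' \<oplus>\<^bsub>R\<^esub> y \<otimes>\<^bsub>R\<^esub> w')
         (z \<otimes>\<^bsub>R\<^esub> x' \<oplus>\<^bsub>R\<^esub> w \<otimes>\<^bsub>R\<^esub> z') (z \<otimes>\<^bsub>R\<^esub> y' \<oplus>\<^bsub>R\<^esub> w \<otimes>\<^bsub>R\<^esub> w')"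

definition mat2_uminus :: "('a, 'm) ring_scheme \<Rightarrow> 'a mat2 \<Rightarrow> 'a mat2" where
  "mat2_uminus R = map_mat2 (\<lambda>x. \<ominus>\<^bsub>R\<^esub> x)"

definition monodromy_mat :: "nat \<Rightarrow> complex \<Rightarrow> nat \<Rightarrow> ncpoly set mat2" where
  "monodromy_mat n q i =
    (let a = cls n q (var (Gen_a i)); b = cls n q (var (Gen_b i)); c = cls n q (var (Gen_c i)) in
     Mat2 (scale n q q a) (\<ominus>\<^bsub>qalg n q\<^esub> b)
          c (\<ominus>\<^bsub>qalg n q\<^esub> (scale n q (1 / q) a)))"

definition braid_image :: "nat \<Rightarrow> complex \<Rightarrow> nat \<Rightarrow> nat \<Rightarrow> ncpoly set mat2" where
  "braid_image n q i j =
    (if j = i then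
       mat2_uminus (qalg n q)
         (mat2_mult (qalg n q) (mat2_mult (qalg n q) (monodromy_mat n q i) (monodromy_mat n q (i + 1))) (monodromy_mat n q i))
     else if j = i + 1 then monodromy_mat n q i
     else monodromy_mat n q j)"

text \<open>The algebra endomorphism obtained by reading off the images of the generators from the
  matrices \<^const>\<open>braid_image\<close>. The generator \<open>a\<^sub>j\<close> can be read off from either diagonal entry;
  the matrix equation requires both readings, i.e. that the image has the shape of \<open>M\<^sub>j\<close>.
  Extensionality makes an endomorphism a unique HOL function.\<close>

definition is_beta :: "nat \<Rightarrow> complex \<Rightarrow> nat \<Rightarrow> (ncpoly set \<Rightarrow> ncpoly set) \<Rightarrow> bool" where
  "is_beta n q i f \<longleftrightarrow>
    f \<in> alg_end n q \<and> f \<in> extensional (carrier (qalg n q)) \<and>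
    (\<forall>j\<in>{1..n - 1}. map_mat2 f (monodromy_mat n q j) = braid_image n q i j)"

lemma free_algebra_minus:
  assumes "p \<in> carrier (free_algebra n)" and "r \<in> carrier (free_algebra n)"
  shows "p - r \<in> carrier (free_algebra n)"
  using assms keys_diff[of p r] by (fastforce simp: free_algebra_def)

lemma free_algebra_add:
  assumes "p \<in> carrier (free_algebra n)" and "r \<in> carrier (free_algebra n)"
  shows "p + r \<in> carrier (free_algebra n)"
  using assms Poly_Mapping.keys_add[of p r] by (fastforce simp: free_algebra_def)

lemma free_algebra_mult:
  assumes "p \<in> carrier (free_algebra n)" and "r \<in> carrier (free_algebra n)"
  shows "p * r \<in> carrier (free_algebra n)"
  using assms keys_mult[of p r] by (fastforce simp: free_algebra_def plus_word_def)

lemma free_algebra_const: "const c \<in> carrier (free_algebra n)"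
  by (simp add: free_algebra_def const_def zero_word_def)

lemma const_1: "const 1 = 1"
  by (simp add: const_def)

lemma free_algebra_var: "g \<in> gens n \<Longrightarrow> var g \<in> carrier (free_algebra n)"
  by (simp add: free_algebra_def var_def)

lemmas free_algebra_closed =
  free_algebra_minus free_algebra_add free_algebra_mult free_algebra_const
  free_algebra_const[of 1, unfolded const_1] free_algebra_var

lemma ring_free_algebra: "ring (free_algebra n)"
proof (rule ringI)
  have zero: "0 \<in> carrier (free_algebra n)"
    by (simp add: free_algebra_def)
  show "abelian_group (free_algebra n)"
  proof (rule abelian_groupI)
    fix p assume p: "p \<in> carrier (free_algebra n)"
    then have "- p \<in> carrier (free_algebra n)"
      using free_algebra_minus[OF zero p] by simp
    then show "\<exists>r\<in>carrier (free_algebra n). r \<oplus>\<^bsub>free_algebra n\<^esub> p = \<zero>\<^bsub>free_algebra n\<^esub>"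
      by (intro bexI[of _ "- p"]) (auto simp: free_algebra_def)
  next
    fix p r assume "p \<in> carrier (free_algebra n)" "r \<in> carrier (free_algebra n)"
    then show "p \<oplus>\<^bsub>free_algebra n\<^esub> r \<in> carrier (free_algebra n)"
      using free_algebra_add[of p n r] by (simp add: free_algebra_def)
  qed (simp_all add: free_algebra_def algebra_simps)
  show "Group.monoid (free_algebra n)"
  proof (rule Group.monoidI)
    fix p r assume "p \<in> carrier (free_algebra n)" "r \<in> carrier (free_algebra n)"
    then show "p \<otimes>\<^bsub>free_algebra n\<^esub> r \<in> carrier (free_algebra n)"
      using free_algebra_mult[of p n r] by (simp add: free_algebra_def)
  next
    show "\<one>\<^bsub>free_algebra n\<^esub> \<in> carrier (free_algebra n)"
      using free_algebra_const[of 1 n, unfolded const_1] by (simp add: free_algebra_def)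
  qed (simp_all add: free_algebra_def mult.assoc)
qed (simp_all add: free_algebra_def algebra_simps)

lemma relators_subset: "relators n q \<subseteq> carrier (free_algebra n)"
proof -
  have var: "var (Gen_a i) \<in> carrier (free_algebra n)" "var (Gen_b i) \<in> carrier (free_algebra n)"
    "var (Gen_c i) \<in> carrier (free_algebra n)" if "i \<in> {1..n - 1}" for i
    using that by (auto simp: gens_def intro!: free_algebra_var)
  show ?thesis
    unfolding relators_def Let_def power2_eq_square
    by (intro Un_least UN_least insert_subsetI empty_subsetI free_algebra_closed(1-5) var; simp)
qed

lemma ideal_rel_ideal: "ideal (rel_ideal n q) (free_algebra n)"
  unfolding rel_ideal_def
  by (rule ring.genideal_ideal[OF ring_free_algebra relators_subset])

lemma ring_qalg: "ring (qalg n q)"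
  unfolding qalg_def by (rule ideal.quotient_is_ring[OF ideal_rel_ideal])

end

theory Submission
  imports Defs
begin

text \<open>Write \<open>R\<close> for the \<open>4 \<times> 4\<close> R-matrix \<open>rmat\<close> below, and \<open>X\<^sub>1\<close>, \<open>X\<^sub>2\<close> for \<open>X\<close> acting on the first and second
  tensor leg. The relations of index \<open>i\<close> say exactly that \<open>M\<^sub>i\<close> has vanishing quantum trace and
  \<open>M\<^sub>i\<^sup>2 = -1\<close>, and they imply the reflection equation for \<open>M\<^sub>i\<close>; the relations of a pair \<open>i < j\<close> say
  exactly that \<open>R (M\<^sub>i)\<^sub>1 R\<^sup>-\<^sup>1\<close> commutes with \<open>(M\<^sub>j)\<^sub>2\<close>. In this form the relations with a third
  matrix are trivially preserved when \<open>(X, Y)\<close> is replaced by \<open>(X Y X\<^sup>-\<^sup>1, X)\<close> or by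
  \<open>(Y, Y\<^sup>-\<^sup>1 X Y)\<close>, and the relation inside the new pair follows from the reflection equation. As
  \<open>X\<^sup>-\<^sup>1 = -X\<close>, these two moves are \<open>\<beta>\<close> and its inverse. The braid identity is then a computation
  with words in the \<open>M\<^sub>i\<close> using only \<open>M\<^sub>i\<^sup>2 = -1\<close>.\<close>

section \<open>Monodromy matrices over a noncommutative ring\<close>

instantiation mat2 :: (ring) ring
begin

definition "0 = Mat2 0 0 0 0"

fun plus_mat2 where
  "Mat2 x y z w + Mat2 x' y' z' w' = Mat2 (x + x') (y + y') (z + z') (w + w')"

fun uminus_mat2 where
  "- Mat2 x y z w = Mat2 (- x) (- y) (- z) (- w)"

definition "X - Y = X + - (Y :: 'a mat2)"

fun times_mat2 where
  "Mat2 x y z w * Mat2 x' y' z' w' =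
    Mat2 (x * x' + y * z') (x * y' + y * w') (z * x' + w * z') (z * y' + w * w')"

instance
proof
  fix X Y Z :: "'a mat2"
  show "X * Y * Z = X * (Y * Z)" "X + Y + Z = X + (Y + Z)" "(X + Y) * Z = X * Z + Y * Z"
    "X * (Y + Z) = X * Y + X * Z"
    by (cases X; cases Y; cases Z; simp add: algebra_simps)+
  show "X + Y = Y + X" "0 + X = X" "- X + X = 0"
    by (cases X; cases Y; simp add: zero_mat2_def add.commute)+
qed (rule minus_mat2_def)

end

text \<open>The unit comes from \<open>monoid_mult\<close> and not from \<open>ring_1\<close>, whose
  axioms include \<open>0 \<noteq> 1\<close>: nontriviality of a ring given by generators and
  relations would need a separate proof.\<close>

instantiation mat2 :: ("{ring, monoid_mult}") monoid_mult
begin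

definition "1 = Mat2 1 0 0 1"

instance
proof
  fix X :: "'a mat2"
  show "1 * X = X" "X * 1 = X"
    by (cases X; simp add: one_mat2_def)+
qed

end

section \<open>Tensor legs and their exchange\<close>

fun leg1 :: "'a::{ring, monoid_mult} mat2 \<Rightarrow> 'a mat2 mat2" where
  "leg1 (Mat2 x y z w) =
    Mat2 (Mat2 x 0 0 x) (Mat2 y 0 0 y) (Mat2 z 0 0 z) (Mat2 w 0 0 w)"

definition leg2 :: "'a::{ring, monoid_mult} mat2 \<Rightarrow> 'a mat2 mat2" where
  "leg2 X = Mat2 X 0 0 X"

text \<open>Exchanges outer and inner matrix positions, that is, conjugates by the permutation of
  the two tensor legs; \<open>flip rmat\<close> is the matrix usually written
  \<open>R\<^sub>2\<^sub>1\<close>.\<close>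

fun flip :: "'a mat2 mat2 \<Rightarrow> 'a mat2 mat2" where
  "flip (Mat2 (Mat2 x0 x1 x2 x3) (Mat2 y0 y1 y2 y3) (Mat2 z0 z1 z2 z3) (Mat2 w0 w1 w2 w3)) =
    Mat2 (Mat2 x0 y0 z0 w0) (Mat2 x1 y1 z1 w1) (Mat2 x2 y2 z2 w2) (Mat2 x3 y3 z3 w3)"

lemma leg_mult: "leg1 (X * Y) = leg1 X * leg1 Y" "leg2 (X * Y) = leg2 X * leg2 Y"
  by (cases X; cases Y; simp add: leg2_def zero_mat2_def)+

lemma leg_one: "leg1 1 = 1" "leg2 1 = 1"
  by (simp_all add: leg2_def one_mat2_def zero_mat2_def)

lemma leg_uminus: "leg1 (- X) = - leg1 X" "leg2 (- X) = - leg2 X"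
  by (cases X; simp add: leg2_def zero_mat2_def)+

text \<open>Only positions of entries are relabelled, so the order of the factors inside each entry
  of a product is kept, as it must be over a noncommutative ring.\<close>

lemma flip_mult: "flip (X * Y) = flip X * flip (Y :: 'a::{ring, monoid_mult} mat2 mat2)"
proof -
  have *: "\<exists>x0 x1 x2 x3 y0 y1 y2 y3 z0 z1 z2 z3 w0 w1 w2 w3.
    X = Mat2 (Mat2 x0 x1 x2 x3) (Mat2 y0 y1 y2 y3) (Mat2 z0 z1 z2 z3) (Mat2 w0 w1 w2 w3)"
    for X :: "'a mat2 mat2"
    by (metis mat2.exhaust)
  from *[of X] *[of Y] show ?thesis
    by (elim exE) (simp add: algebra_simps)
qed

lemma flip_leg: "flip (leg1 X) = leg2 X" "flip (leg2 X) = leg1 X"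
  by (cases X; simp add: leg2_def zero_mat2_def)+

lemma flip_flip: "flip (flip X) = X"
  by (metis flip.simps mat2.exhaust)

lemma flip_eq_iff: "flip X = flip Y \<longleftrightarrow> X = Y"
  by (metis flip_flip)

section \<open>The R-matrix, exchange relations and the reflection equation\<close>

locale quantum_parameter =
  fixes q p :: "'a::{ring, monoid_mult}"
  assumes q_central: "q * x = x * q"
    and qp: "q * p = 1"
begin

lemma pq: "p * q = 1"
  using q_central[of p] qp by simp

lemma p_central: "p * x = x * p"
proof -
  have "p * x = p * (x * q) * p"
    by (simp add: mult.assoc qp)
  also have "\<dots> = x * p"
    by (simp add: q_central[symmetric] mult.assoc[symmetric] pq qp)
  finally show ?thesis .
qed

lemma cancel: "q * (p * x) = x" "p * (q * x) = x"
  by (simp_all add: mult.assoc[symmetric] pq qp)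

text \<open>Up to normalisation, the standard triangular R-matrix of quantum \<open>sl(2)\<close> at
  parameter \<open>p\<close>. Its inverse results from exchanging \<open>p\<close> and
  \<open>q\<close>.\<close>

definition rmat :: "'a mat2 mat2" where
  "rmat = Mat2 (Mat2 p 0 0 1) (Mat2 0 0 (p - q) 0) 0 (Mat2 1 0 0 p)"

definition rmat_inv :: "'a mat2 mat2" where
  "rmat_inv = Mat2 (Mat2 q 0 0 1) (Mat2 0 0 (q - p) 0) 0 (Mat2 1 0 0 q)"

lemma rmat_inverse: "rmat * rmat_inv = 1" "rmat_inv * rmat = 1"
  by (simp_all add: rmat_def rmat_inv_def one_mat2_def zero_mat2_def pq qp)

lemma flip_rmat_inverse: "flip rmat * flip rmat_inv = 1" "flip rmat_inv * flip rmat = 1"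
  by (simp_all add: flip_mult[symmetric] rmat_inverse leg_one(1)[symmetric] flip_leg leg_one(2) del: leg1.simps)

definition linked :: "'a mat2 \<Rightarrow> 'a mat2 \<Rightarrow> bool" where
  "linked X Y \<longleftrightarrow> rmat * leg1 X * rmat_inv * leg2 Y = leg2 Y * (rmat * leg1 X * rmat_inv)"

definition reflective :: "'a mat2 \<Rightarrow> bool" where
  "reflective X \<longleftrightarrow> rmat * leg1 X * flip rmat * leg2 X = leg2 X * rmat * leg1 X * flip rmat"

lemma cancel_left: "x * y = 1 \<Longrightarrow> x * (y * z) = (z :: 'b::monoid_mult)"
  by (simp add: mult.assoc[symmetric])

lemmas rmat_cancel = rmat_inverse rmat_inverse[THEN cancel_left]
  flip_rmat_inverse flip_rmat_inverse[THEN cancel_left]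

lemma commute_mult: "k * x = x * k \<Longrightarrow> k * y = y * k \<Longrightarrow> k * (x * y) = x * y * (k :: 'b::monoid_mult)"
  by (metis mult.assoc)

lemma linked_mult_right: "linked X Y \<Longrightarrow> linked X Z \<Longrightarrow> linked X (Y * Z)"
  unfolding linked_def leg_mult by (rule commute_mult)

text \<open>Conjugation by \<open>rmat\<close> is multiplicative, so the matrices linked to a fixed
  \<open>Z\<close> form the preimage of a commutant and are closed under products.\<close>

lemma linked_mult_left:
  assumes "linked X Z" "linked Y Z"
  shows "linked (X * Y) Z"
proof -
  have eq: "rmat * leg1 (X * Y) * rmat_inv = (rmat * leg1 X * rmat_inv) * (rmat * leg1 Y * rmat_inv)"
    by (simp only: leg_mult mult.assoc rmat_inverse[THEN cancel_left])
  show ?thesis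
    using assms unfolding linked_def eq by (intro commute_mult[symmetric]) simp_all
qed

lemma linked_uminus: "linked (- X) Y = linked X Y" "linked X (- Y) = linked X Y"
  by (simp_all add: linked_def leg_uminus)

text \<open>Moves the second matrix of the pair into the first leg, where the conjugates below are
  formed.\<close>

lemma linked_flip:
  "linked X Y \<longleftrightarrow>
    flip rmat * leg2 X * flip rmat_inv * leg1 Y = leg1 Y * (flip rmat * leg2 X * flip rmat_inv)"
  unfolding linked_def
  by (subst flip_eq_iff[symmetric]) (simp only: flip_mult flip_leg)

lemma leg1_inverse: "X * V = 1 \<Longrightarrow> leg1 X * leg1 V = 1"
  by (simp add: leg_mult[symmetric] leg_one)

text \<open>The reflection equation read as an intertwining relation: \<open>rmat * leg1 X\<close>
  carries \<open>flip rmat * leg2 X * flip rmat_inv\<close> to \<open>leg2 X\<close>.\<close>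

lemma reflective_conj:
  assumes "reflective X"
  shows "rmat * leg1 X * (flip rmat * leg2 X * flip rmat_inv) = leg2 X * rmat * leg1 X"
  using arg_cong[OF assms[unfolded reflective_def], of "\<lambda>Z. Z * flip rmat_inv"]
  by (simp only: mult.assoc rmat_cancel mult_1_right)

text \<open>By the flipped link, \<open>S\<close> commutes with \<open>leg1 Y\<close>; by the
  reflection equation, conjugation by \<open>rmat * leg1 X\<close> turns \<open>S\<close> into
  \<open>leg2 X\<close>. Hence it turns \<open>leg1 Y\<close> into something that commutes with
  \<open>leg2 X\<close>.\<close>

lemma linked_conj_left:
  assumes "linked X Y" "reflective X" and inv: "X * V = 1" "V * X = 1"
  shows "linked (X * Y * V) X"
proof -
  define S where "S = flip rmat * leg2 X * flip rmat_inv"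
  have c: "S * leg1 Y = leg1 Y * S"
    using assms(1) unfolding linked_flip S_def .
  have XS: "rmat * leg1 X * S = leg2 X * rmat * leg1 X"
    using reflective_conj[OF assms(2)] unfolding S_def .
  note cancels = rmat_cancel inv[THEN leg1_inverse] inv[THEN leg1_inverse, THEN cancel_left]
  \<comment> \<open>The relation \<open>XS\<close>, multiplied on both sides by the inverse of
    \<open>rmat * leg1 X\<close>.\<close>
  have D: "leg1 V * rmat_inv * leg2 X = S * leg1 V * rmat_inv"
  proof -
    have "leg1 V * rmat_inv * leg2 X = leg1 V * rmat_inv * (leg2 X * rmat * leg1 X) * leg1 V * rmat_inv"
      by (simp only: mult.assoc cancels mult_1_right mult_1_left)
    also have "\<dots> = S * leg1 V * rmat_inv"
      unfolding XS[symmetric] by (simp only: mult.assoc cancels mult_1_left mult_1_right)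
    finally show ?thesis .
  qed
  have "rmat * leg1 (X * Y * V) * rmat_inv * leg2 X
      = rmat * leg1 X * leg1 Y * (leg1 V * rmat_inv * leg2 X)"
    by (simp only: leg_mult mult.assoc)
  also have "\<dots> = rmat * leg1 X * (S * leg1 Y) * leg1 V * rmat_inv"
    unfolding D c by (simp only: mult.assoc)
  also have "\<dots> = (rmat * leg1 X * S) * leg1 Y * leg1 V * rmat_inv"
    by (simp only: mult.assoc)
  also have "\<dots> = leg2 X * (rmat * leg1 (X * Y * V) * rmat_inv)"
    unfolding XS by (simp only: leg_mult mult.assoc)
  finally show ?thesis
    by (simp only: linked_def)
qed

text \<open>The mirror argument: \<open>S\<close> commutes with \<open>leg1 X\<close> and
  \<open>W\<close> intertwines it with \<open>leg2 Y\<close>, so \<open>W' * leg1 X * W\<close>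
  commutes with \<open>leg2 Y\<close>. Conjugating by \<open>flip rmat\<close> gives the flipped
  form of the claim.\<close>

lemma linked_conj_right:
  assumes "linked X Y" "reflective Y" and inv: "Y * V = 1" "V * Y = 1"
  shows "linked Y (V * X * Y)"
proof -
  define S where "S = rmat_inv * leg2 Y * rmat"
  define W where "W = leg1 Y * flip rmat"
  define W' where "W' = flip rmat_inv * leg1 V"
  note cancels = rmat_cancel inv[THEN leg1_inverse] inv[THEN leg1_inverse, THEN cancel_left]
  have W: "W * W' = 1" "W' * W = 1"
    by (simp_all only: W_def W'_def mult.assoc cancels)
  have c: "leg1 X * S = S * leg1 X"
    using arg_cong[OF assms(1)[unfolded linked_def], of "\<lambda>Z. rmat_inv * Z * rmat"]
    by (simp only: S_def mult.assoc cancels mult_1_right)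
  have SW: "S * W = W * leg2 Y"
    using arg_cong[OF assms(2)[unfolded reflective_def], of "\<lambda>Z. rmat_inv * Z"]
    by (simp only: S_def W_def mult.assoc cancels)
  have WS: "leg2 Y * W' = W' * S"
    using arg_cong[OF SW, of "\<lambda>Z. W' * Z * W'"]
    by (simp only: mult.assoc W W[THEN cancel_left] mult_1_right)
  have "leg2 Y * (W' * leg1 X * W) = W' * (S * leg1 X) * W"
    by (simp only: mult.assoc[symmetric] WS)
  also have "\<dots> = W' * leg1 X * (S * W)"
    unfolding c[symmetric] by (simp only: mult.assoc)
  also have "\<dots> = W' * leg1 X * W * leg2 Y"
    unfolding SW by (simp only: mult.assoc)
  finally have "flip rmat * (leg2 Y * (W' * leg1 X * W)) * flip rmat_inv
      = flip rmat * (W' * leg1 X * W * leg2 Y) * flip rmat_inv"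
    by (rule arg_cong)
  then show ?thesis
    by (simp only: linked_flip W_def W'_def leg_mult mult.assoc cancels mult_1_right)
qed

section \<open>The defining relations as matrix identities\<close>

definition monodromy :: "'a \<Rightarrow> 'a \<Rightarrow> 'a \<Rightarrow> 'a mat2" where
  "monodromy a b c = Mat2 (q * a) (- b) c (- (p * a))"

text \<open>The conjuncts here and in \<open>link\<close> follow the order of
  \<open>relators\<close>, with squares written as products, so that they can later be matched with
  the relators one at a time.\<close>

definition node :: "'a \<Rightarrow> 'a \<Rightarrow> 'a \<Rightarrow> bool" where
  "node a b c \<longleftrightarrow>
    q * a * b = p * b * a \<and> p * a * c = q * c * a \<and>
    b * c - c * b = (q * q - p * p) * (a * a) \<and> b * c = q * q * (a * a) + 1"

definition link :: "'a \<Rightarrow> 'a \<Rightarrow> 'a \<Rightarrow> 'a \<Rightarrow> 'a \<Rightarrow> 'a \<Rightarrow> bool" where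
  "link a b c a' b' c' \<longleftrightarrow>
    p * b * b' = q * b' * b \<and> p * c * c' = q * c' * c \<and> a * b' = b' * a \<and> c * a' = a' * c \<and>
    q * c * b' = p * b' * c \<and>
    b * a' = a' * b + (q * q - p * p) * a * b' \<and>
    a * c' = c' * a + (q * q - p * p) * c * a' \<and>
    a * a' = a' * a + (1 - p * p) * b' * c \<and>
    a * a' = a' * a + (q * q - 1) * c * b' \<and>
    q * b * c' + q * (p * p - q * q) * a * a' = p * c' * b - p * (p * p - q * q) * a' * a"

text \<open>Always instantiated at generators before rewriting: with a scalar in place of
  \<open>x\<close> the rules would permute \<open>q\<close> and \<open>p\<close> forever.\<close>

lemma central_left: "x * q = q * x" "x * (q * y) = q * (x * y)" "x * p = p * x" "x * (p * y) = p * (x * y)"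
  using q_central[of x] p_central[of x] by (metis mult.assoc)+

lemmas expand = mult.assoc distrib_left distrib_right left_diff_distrib right_diff_distrib
  minus_mult_left[symmetric] minus_mult_right[symmetric] mult_1_left mult_1_right mult_zero_left mult_zero_right qp pq cancel

lemma scalar_eq_iff: "q * x = q * y \<longleftrightarrow> x = y" "p * x = p * y \<longleftrightarrow> x = y"
  by (metis cancel)+

lemma node_rules:
  assumes "node a b c"
  shows "b * a = q * (q * (a * b))" "c * a = p * (p * (a * c))"
    "b * c = q * (q * (a * a)) + 1" "c * b = p * (p * (a * a)) + 1"
proof -
  have 1: "q * (a * b) = p * (b * a)" and 2: "p * (a * c) = q * (c * a)"
    and 3: "b * c = q * (q * (a * a)) + 1"
    and 4: "b * c - c * b = q * (q * (a * a)) - p * (p * (a * a))"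
    using assms unfolding node_def mult.assoc left_diff_distrib by blast+
  show "b * a = q * (q * (a * b))" using arg_cong[OF 1, of "\<lambda>x. q * x"] by (simp only: cancel)
  show "c * a = p * (p * (a * c))" using arg_cong[OF 2, of "\<lambda>x. p * x"] by (simp only: cancel)
  show "b * c = q * (q * (a * a)) + 1" by (fact 3)
  show "c * b = p * (p * (a * a)) + 1" using 4 unfolding 3 by (simp add: algebra_simps)
qed

text \<open>The off-diagonal entries of the square are the two commutation relations with
  \<open>a\<close>. The diagonal entries give \<open>b * c\<close> and \<open>c * b\<close>, whose
  difference is the remaining relation.\<close>

lemma node_iff: "node a b c \<longleftrightarrow> monodromy a b c * monodromy a b c = - 1" (is "?N \<longleftrightarrow> ?M")
proof
  assume ?N
  note r = node_rules[OF this]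
  show ?M
    unfolding monodromy_def one_mat2_def times_mat2.simps uminus_mat2.simps mat2.inject
    by (simp only: expand central_left[of a] central_left[of b] central_left[of c] r) (simp add: cancel)
next
  note central = central_left[of a] central_left[of b] central_left[of c]
  assume m: ?M
  have "q * (q * (a * a)) - b * c = - 1" "p * (p * (a * a)) - c * b = - 1"
    and m: "q * (a * b) = p * (b * a)" "p * (a * c) = q * (c * a)"
    using m unfolding monodromy_def one_mat2_def times_mat2.simps uminus_mat2.simps mat2.inject expand central
    by simp_all
  then have "b * c = q * (q * (a * a)) + 1" "c * b = p * (p * (a * a)) + 1"
    by (simp_all add: algebra_simps)
  with m show ?N
    unfolding node_def expand by simp
qed

text \<open>Ordering the monomials of every entry by \<open>node_rules\<close> brings both sides of
  the reflection equation to the same normal form.\<close>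

lemma reflective_monodromy:
  assumes "node a b c"
  shows "reflective (monodromy a b c)"
proof -
  note central = central_left[of a] central_left[of b] central_left[of c]
  show ?thesis
    unfolding reflective_def monodromy_def rmat_def leg2_def zero_mat2_def
    by (simp, simp only: expand central node_rules[OF assms], simp add: algebra_simps)
qed

text \<open>Rewrite rules that move the generators of smaller index to the left.\<close>

lemma link_rules:
  assumes "link a b c a' b' c'"
  shows "b' * b = p * (p * (b * b'))" "c' * c = p * (p * (c * c'))" "b' * a = a * b'" "a' * c = c * a'"
    "b' * c = q * (q * (c * b'))" "a' * b = b * a' - q * (q * (a * b')) + p * (p * (a * b'))"
    "c' * a = a * c' - q * (q * (c * a')) + p * (p * (c * a'))"
    "a' * a = a * a' - q * (q * (c * b')) + c * b'"
    "c' * b = q * (q * (b * c')) + (a * a' - q * (q * (q * (q * (a * a'))))) + (p * (p * (a' * a)) - q * (q * (a' * a)))"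
proof -
  note l = assms[unfolded link_def expand]
  have 1: "p * (b * b') = q * (b' * b)" "p * (c * c') = q * (c' * c)" "q * (c * b') = p * (b' * c)"
    using l by blast+
  show "b' * b = p * (p * (b * b'))" "c' * c = p * (p * (c * c'))" "b' * c = q * (q * (c * b'))"
    using 1[THEN arg_cong, of "\<lambda>x. p * x"] 1[THEN arg_cong, of "\<lambda>x. q * x"] by (simp_all only: cancel)
  have 2: "b * a' = a' * b + (q * (q * (a * b')) - p * (p * (a * b')))"
    "a * c' = c' * a + (q * (q * (c * a')) - p * (p * (c * a')))"
    "a * a' = a' * a + (q * (q * (c * b')) - c * b')"
    using l by blast+
  show "a' * b = b * a' - q * (q * (a * b')) + p * (p * (a * b'))"
    "c' * a = a * c' - q * (q * (c * a')) + p * (p * (c * a'))"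
    "a' * a = a * a' - q * (q * (c * b')) + c * b'"
    unfolding 2 by simp_all
  show "b' * a = a * b'" "a' * c = c * a'"
    using l by simp_all
  have "q * (b * c') + (p * (a * a') - q * (q * (q * (a * a')))) = p * (c' * b) - (p * (p * (p * (a' * a))) - q * (a' * a))"
    using l by blast
  from arg_cong[OF this, of "\<lambda>x. q * x"]
  show "c' * b = q * (q * (b * c')) + (a * a' - q * (q * (q * (q * (a * a'))))) + (p * (p * (a' * a)) - q * (q * (a' * a)))"
    by (simp only: expand) (simp add: algebra_simps)
qed

text \<open>Ordering by \<open>link_rules\<close> makes all sixteen entries agree. Conversely, each
  of the ten relations is recovered from one of the entries, up to central factors and substitution
  of simpler relations.\<close>

lemma link_iff: "link a b c a' b' c' \<longleftrightarrow> linked (monodromy a b c) (monodromy a' b' c')" (is "?N \<longleftrightarrow> ?M")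
proof
  assume ?N
  note r = link_rules[OF this]
  note central = central_left[of a] central_left[of b] central_left[of c]
    central_left[of a'] central_left[of b'] central_left[of c']
  show ?M
    unfolding linked_def monodromy_def rmat_def rmat_inv_def leg2_def zero_mat2_def
    by (simp, simp only: expand central r, simp add: algebra_simps)
next
  note central = central_left[of a] central_left[of b] central_left[of c]
    central_left[of a'] central_left[of b'] central_left[of c']
  assume m: ?M
  have m: "- (c * b' - q * (q * (c * b'))) - a * a' = - (a' * a)"
    "- (b * a') = - (a' * b) - (q * (q * (b' * a)) - b' * a - (p * (p * (b' * a)) - b' * a))"
    "p * (b * b') = q * (b' * b)"
    "q * (q * (q * (a * a'))) - q * (a * a') - (p * (a * a') - q * (a * a')) - q * (b * c') =
      - (p * (c' * b)) - (q * (a' * a) - p * (a' * a) - (p * (p * (p * (a' * a))) - p * (a' * a)))"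
    "c * a' = a' * c"
    "q * (c * b') = p * (b' * c)"
    "p * (c * c') = q * (c' * c)"
    "- (a * a') = - (a' * a) - (b' * c - p * (p * (b' * c)))"
    "a * b' = b' * a"
    "q * (c * a') - p * (c * a') - p * (a * c') = - (p * (c' * a)) - (p * (a' * c) - p * (p * (p * (a' * c))))"
    using m[unfolded linked_def monodromy_def rmat_def rmat_inv_def leg2_def zero_mat2_def, simplified,
      unfolded expand central scalar_eq_iff]
    by blast+
  \<comment> \<open>The corresponding entry contains both \<open>c * a'\<close> and
    \<open>a' * c\<close>; the relation \<open>m(5)\<close> merges them.\<close>
  have 1: "a * c' = c' * a + (q * (q * (c * a')) - p * (p * (c * a')))"
    using m(10)[THEN arg_cong, of "\<lambda>x. q * x"] unfolding m(5)[symmetric]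
    by (simp only: expand) (simp add: algebra_simps)
  show ?N
    unfolding link_def expand
  proof (intro conjI)
    show "a * c' = c' * a + (q * (q * (c * a')) - p * (p * (c * a')))" by (fact 1)
    show "b * a' = a' * b + (q * (q * (a * b')) - p * (p * (a * b')))"
      using m(2) unfolding m(9)[symmetric] by (simp add: algebra_simps)
    show "a * a' = a' * a + (b' * c - p * (p * (b' * c)))" "a * a' = a' * a + (q * (q * (c * b')) - c * b')"
       "q * (b * c') + (p * (a * a') - q * (q * (q * (a * a')))) = p * (c' * b) - (p * (p * (p * (a' * a))) - q * (a' * a))"
      using m(8) m(1) m(4) by (simp_all add: algebra_simps)
  qed (fact m)+
qed

section \<open>Quantum trace and admissible matrices\<close>

definition qtrace :: "'a mat2 \<Rightarrow> 'a" where
  "qtrace X = (case X of Mat2 x y z w \<Rightarrow> p * x + q * w)"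

text \<open>Ensures that the conjugated matrices again have the shape of \<open>monodromy\<close>.
  Their diagonal entries are cubic in the generators; after ordering by the node and link relations
  the terms of the trace cancel.\<close>

lemma qtrace_conj:
  assumes "node a b c" "node a' b' c'" "link a b c a' b' c'"
  shows "qtrace (monodromy a b c * monodromy a' b' c' * monodromy a b c) = 0"
    "qtrace (monodromy a' b' c' * monodromy a b c * monodromy a' b' c') = 0"
proof -
  \<comment> \<open>In a right-nested product a rule for \<open>x * y\<close> misses an adjacent
    pair that is followed by further factors; \<open>tail\<close> supplies that version.\<close>
  have tail: "x * y = z \<Longrightarrow> x * (y * t) = z * t" for x y z t :: 'a
    by (simp add: mult.assoc[symmetric])
  note r = node_rules[OF assms(1)] node_rules[OF assms(2)] link_rules[OF assms(3)]
  note r = r r[THEN tail]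
  note central = central_left[of a] central_left[of b] central_left[of c]
    central_left[of a'] central_left[of b'] central_left[of c']
  show "qtrace (monodromy a b c * monodromy a' b' c' * monodromy a b c) = 0"
    by (simp add: qtrace_def monodromy_def, simp only: expand central r, simp add: algebra_simps)
  show "qtrace (monodromy a' b' c' * monodromy a b c * monodromy a' b' c') = 0"
    by (simp add: qtrace_def monodromy_def, simp only: expand central r, simp add: algebra_simps)
qed

definition admissible :: "'a mat2 \<Rightarrow> bool" where
  "admissible X \<longleftrightarrow> qtrace X = 0 \<and> X * X = - 1"

text \<open>Vanishing of \<open>qtrace\<close> says that both diagonal entries yield the same
  \<open>a\<close>, namely \<open>p\<close> times the upper one; \<open>node_iff\<close> accounts
  for the square.\<close>

lemma admissible_iff: "admissible X \<longleftrightarrow> (\<exists>a b c. X = monodromy a b c \<and> node a b c)"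
proof
  assume *: "admissible X"
  obtain x y z w where X: "X = Mat2 x y z w"
    by (cases X)
  have "q * w = - (p * x)"
    using * by (simp add: admissible_def qtrace_def X eq_neg_iff_add_eq_0 add.commute)
  then have "p * (q * w) = - (p * (p * x))"
    by simp
  then have "X = monodromy (p * x) (- y) z"
    by (simp add: monodromy_def X cancel)
  with * show "\<exists>a b c. X = monodromy a b c \<and> node a b c"
    unfolding admissible_def node_iff by metis
next
  assume "\<exists>a b c. X = monodromy a b c \<and> node a b c"
  then show "admissible X"
    unfolding admissible_def node_iff by (auto simp: monodromy_def qtrace_def cancel)
qed

lemma qtrace_uminus: "qtrace (- X) = - qtrace X"
  by (cases X) (simp add: qtrace_def)

lemma admissible_conj:
  assumes "admissible X" "admissible Y" "linked X Y"
  shows "admissible (- (X * Y * X))" "admissible (- (Y * X * Y))"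
proof -
  have square: "X * X = - 1" "Y * Y = - 1"
    using assms by (simp_all add: admissible_def)
  have "X * Y * X * (X * Y * X) = - 1" if "X * X = - 1" "Y * Y = - 1" for X Y :: "'a mat2"
  proof -
    have "X * Y * X * (X * Y * X) = X * (Y * (X * X) * Y) * X"
      by (simp only: mult.assoc)
    then show ?thesis by (simp add: that)
  qed
  moreover have "qtrace (X * Y * X) = 0" "qtrace (Y * X * Y) = 0"
    using assms qtrace_conj unfolding admissible_iff by (metis link_iff)+
  ultimately show "admissible (- (X * Y * X))" "admissible (- (Y * X * Y))"
    using square by (simp_all add: admissible_def qtrace_uminus)
qed

lemma linked_braid:
  assumes "admissible X" "admissible Y" "linked X Y"
  shows "linked (- (X * Y * X)) X" "linked Y (- (Y * X * Y))"
proof -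
  have inv: "X * - X = 1" "- X * X = 1" "Y * - Y = 1" "- Y * Y = 1"
    using assms by (simp_all add: admissible_def)
  have "reflective X" "reflective Y"
    using assms reflective_monodromy unfolding admissible_iff by blast+
  then have "linked (X * Y * - X) X" "linked Y (- Y * X * Y)"
    using linked_conj_left linked_conj_right assms inv by blast+
  then show "linked (- (X * Y * X)) X" "linked Y (- (Y * X * Y))"
    by simp_all
qed

section \<open>Braid moves on families of matrices\<close>

definition consistent :: "nat \<Rightarrow> (nat \<Rightarrow> 'a mat2) \<Rightarrow> bool" where
  "consistent m M \<longleftrightarrow>
    (\<forall>j\<in>{1..m}. admissible (M j)) \<and> (\<forall>j\<in>{1..m}. \<forall>k\<in>{j<..m}. linked (M j) (M k))"

definition braid :: "nat \<Rightarrow> (nat \<Rightarrow> 'a mat2) \<Rightarrow> nat \<Rightarrow> 'a mat2" where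
  "braid i M = M(i := - (M i * M (i + 1) * M i), i + 1 := M i)"

definition braid_inv :: "nat \<Rightarrow> (nat \<Rightarrow> 'a mat2) \<Rightarrow> nat \<Rightarrow> 'a mat2" where
  "braid_inv i M = M(i := M (i + 1), i + 1 := - (M (i + 1) * M i * M (i + 1)))"

text \<open>Inside the moved pair the link is \<open>linked_braid\<close>. Links with a third matrix
  on either side survive because both new matrices are, up to sign, products of the old two.\<close>

lemma consistent_braid:
  assumes "consistent m M" "1 \<le> i" "i < m"
  shows "consistent m (braid i M)" "consistent m (braid_inv i M)"
proof -
  have adm: "admissible (M j)" if "1 \<le> j" "j \<le> m" for j
    using assms(1) that by (auto simp: consistent_def)
  have lnk: "linked (M j) (M k)" if "1 \<le> j" "j < k" "k \<le> m" for j k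
    using assms(1) that by (auto simp: consistent_def)
  have pair: "admissible (M i)" "admissible (M (i + 1))" "linked (M i) (M (i + 1))"
    using assms(2,3) by (auto intro: adm lnk)
  note new = admissible_conj[OF pair] linked_braid[OF pair]
  show "consistent m (braid i M)" "consistent m (braid_inv i M)"
    using assms(2,3) new
    by (auto simp: consistent_def braid_def braid_inv_def linked_uminus
        intro!: linked_mult_left linked_mult_right adm lnk)
qed

end

section \<open>Quotients of the free algebra\<close>

lemma free_algebra_ops:
  "p \<otimes>\<^bsub>free_algebra n\<^esub> r = p * r" "p \<oplus>\<^bsub>free_algebra n\<^esub> r = p + r"
  "\<one>\<^bsub>free_algebra n\<^esub> = 1" "\<zero>\<^bsub>free_algebra n\<^esub> = 0"
  by (simp_all add: free_algebra_def)

lemma free_algebra_uminus: "p \<in> carrier (free_algebra n) \<Longrightarrow> - p \<in> carrier (free_algebra n)"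
  by (simp add: free_algebra_def)

lemma cls_ring_hom: "cls n q \<in> ring_hom (free_algebra n) (qalg n q)"
  using ideal.rcos_ring_hom[OF ideal_rel_ideal, of n q] unfolding cls_def qalg_def .

lemma cls_closed: "p \<in> carrier (free_algebra n) \<Longrightarrow> cls n q p \<in> carrier (qalg n q)"
  by (rule ring_hom_closed[OF cls_ring_hom])

lemma cls_mult:
  "p \<in> carrier (free_algebra n) \<Longrightarrow> r \<in> carrier (free_algebra n) \<Longrightarrow>
    cls n q (p * r) = cls n q p \<otimes>\<^bsub>qalg n q\<^esub> cls n q r"
  using ring_hom_mult[OF cls_ring_hom, of p n r q] by (simp add: free_algebra_ops)

lemma cls_add:
  "p \<in> carrier (free_algebra n) \<Longrightarrow> r \<in> carrier (free_algebra n) \<Longrightarrow>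
    cls n q (p + r) = cls n q p \<oplus>\<^bsub>qalg n q\<^esub> cls n q r"
  using ring_hom_add[OF cls_ring_hom, of p n r q] by (simp add: free_algebra_ops)

lemma cls_one: "cls n q 1 = \<one>\<^bsub>qalg n q\<^esub>"
  using ring_hom_one[OF cls_ring_hom, of n q] by (simp add: free_algebra_ops)

lemma cls_zero: "cls n q 0 = \<zero>\<^bsub>qalg n q\<^esub>"
  using ring_hom_zero[OF cls_ring_hom ring_free_algebra ring_qalg, of n q] by (simp add: free_algebra_ops)

lemma cls_uminus:
  assumes "p \<in> carrier (free_algebra n)"
  shows "cls n q (- p) = \<ominus>\<^bsub>qalg n q\<^esub> cls n q p"
proof (rule sym, rule abelian_group.minus_equality)
  show "abelian_group (qalg n q)"
    by (rule ring.is_abelian_group[OF ring_qalg])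
  show "cls n q (- p) \<oplus>\<^bsub>qalg n q\<^esub> cls n q p = \<zero>\<^bsub>qalg n q\<^esub>"
    using assms by (simp add: cls_add[symmetric] free_algebra_uminus cls_zero)
qed (use assms in \<open>auto intro: cls_closed free_algebra_uminus\<close>)

lemma cls_surj:
  assumes "x \<in> carrier (qalg n q)"
  obtains p where "p \<in> carrier (free_algebra n)" "x = cls n q p"
  using assms unfolding qalg_def cls_def FactRing_def A_RCOSETS_def' by auto

lemma cls_eq_iff:
  assumes "p \<in> carrier (free_algebra n)" "r \<in> carrier (free_algebra n)"
  shows "cls n q p = cls n q r \<longleftrightarrow> p - r \<in> rel_ideal n q"
proof -
  interpret ideal "rel_ideal n q" "free_algebra n"
    by (rule ideal_rel_ideal)
  have neg: "\<ominus>\<^bsub>free_algebra n\<^esub> r = - r"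
    using assms(2) by (intro minus_equality) (auto simp: free_algebra_ops intro: free_algebra_uminus)
  show ?thesis
    using quotient_eq_iff_same_a_r_cos[OF ideal_axioms assms] unfolding cls_def
    by (simp add: a_minus_def neg free_algebra_ops)
qed

lemma cls_eqI:
  assumes "p - r \<in> relators n q" "p \<in> carrier (free_algebra n)" "r \<in> carrier (free_algebra n)"
  shows "cls n q p = cls n q r"
  using assms ring.genideal_self[OF ring_free_algebra relators_subset, of n q]
  unfolding cls_eq_iff[OF assms(2,3)] rel_ideal_def by auto

text \<open>A ring type that contains every \<open>qalg n q\<close> as a factor, so that the type-class results above
  apply to all of them at once.\<close>

typedef quantum_product = "{f :: nat \<times> complex \<Rightarrow> ncpoly set. \<forall>i. f i \<in> carrier (case_prod qalg i)}"
  by (rule exI[of _ "\<lambda>i. \<zero>\<^bsub>case_prod qalg i\<^esub>"]) (auto intro: ring.ring_simprules ring_qalg)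

setup_lifting type_definition_quantum_product

lemma ring_case_prod_qalg: "ring (case_prod qalg i)"
  by (cases i) (simp add: ring_qalg)

instantiation quantum_product :: ring
begin

lift_definition zero_quantum_product :: quantum_product is "\<lambda>i. \<zero>\<^bsub>case_prod qalg i\<^esub>"
  by (intro ring.ring_simprules ring_case_prod_qalg)

lift_definition plus_quantum_product :: "quantum_product \<Rightarrow> quantum_product \<Rightarrow> quantum_product"
  is "\<lambda>s t i. s i \<oplus>\<^bsub>case_prod qalg i\<^esub> t i"
  by (intro ring.ring_simprules ring_case_prod_qalg) simp_all

lift_definition uminus_quantum_product :: "quantum_product \<Rightarrow> quantum_product"
  is "\<lambda>s i. \<ominus>\<^bsub>case_prod qalg i\<^esub> s i"
  by (intro ring.ring_simprules ring_case_prod_qalg) simp_all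

lift_definition minus_quantum_product :: "quantum_product \<Rightarrow> quantum_product \<Rightarrow> quantum_product"
  is "\<lambda>s t i. s i \<ominus>\<^bsub>case_prod qalg i\<^esub> t i"
  by (intro ring.ring_simprules ring_case_prod_qalg) simp_all

lift_definition times_quantum_product :: "quantum_product \<Rightarrow> quantum_product \<Rightarrow> quantum_product"
  is "\<lambda>s t i. s i \<otimes>\<^bsub>case_prod qalg i\<^esub> t i"
  by (intro ring.ring_simprules ring_case_prod_qalg) simp_all

instance
proof
  fix s t u :: quantum_product
  show "s + t + u = s + (t + u)"
    by transfer (simp add: abelian_monoid.a_assoc[OF abelian_group.axioms(1)[OF ring.is_abelian_group[OF ring_qalg]]] fun_eq_iff)
  show "s + t = t + s"
    by transfer (simp add: abelian_monoid.a_comm[OF abelian_group.axioms(1)[OF ring.is_abelian_group[OF ring_qalg]]] fun_eq_iff)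
  show "0 + s = s"
    by transfer (simp add: abelian_monoid.l_zero[OF abelian_group.axioms(1)[OF ring.is_abelian_group[OF ring_qalg]]] fun_eq_iff)
  show "- s + s = 0"
    by transfer (simp add: abelian_group.l_neg[OF ring.is_abelian_group[OF ring_qalg]] fun_eq_iff)
  show "s - t = s + - t"
    by transfer (simp add: a_minus_def)
  show "s * t * u = s * (t * u)"
    by transfer (simp add: Group.monoid.m_assoc[OF ring.is_monoid[OF ring_qalg]] fun_eq_iff)
  show "(s + t) * u = s * u + t * u"
    by transfer (simp add: ring.ring_simprules(13)[OF ring_qalg] fun_eq_iff)
  show "s * (t + u) = s * t + s * u"
    by transfer (simp add: ring.ring_simprules(23)[OF ring_qalg] fun_eq_iff)
qed

end

instantiation quantum_product :: monoid_mult
begin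

lift_definition one_quantum_product :: quantum_product is "\<lambda>i. \<one>\<^bsub>case_prod qalg i\<^esub>"
  by (intro ring.ring_simprules ring_case_prod_qalg)

instance
proof
  fix s :: quantum_product
  show "1 * s = s"
    by transfer (simp add: Group.monoid.l_one[OF ring.is_monoid[OF ring_qalg]] fun_eq_iff)
  show "s * 1 = s"
    by transfer (simp add: Group.monoid.r_one[OF ring.is_monoid[OF ring_qalg]] fun_eq_iff)
qed

end

definition component :: "nat \<Rightarrow> complex \<Rightarrow> quantum_product \<Rightarrow> ncpoly set" where
  "component n q t = Rep_quantum_product t (n, q)"

lemma component_closed: "component n q t \<in> carrier (qalg n q)"
  using Rep_quantum_product[of t] by (auto simp: component_def)

lemma component_hom:
  "component n q (s + t) = component n q s \<oplus>\<^bsub>qalg n q\<^esub> component n q t"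
  "component n q (s * t) = component n q s \<otimes>\<^bsub>qalg n q\<^esub> component n q t"
  "component n q (- t) = \<ominus>\<^bsub>qalg n q\<^esub> component n q t"
  "component n q 0 = \<zero>\<^bsub>qalg n q\<^esub>"
  "component n q 1 = \<one>\<^bsub>qalg n q\<^esub>"
  by (simp_all add: component_def zero_quantum_product.rep_eq one_quantum_product.rep_eq
      plus_quantum_product.rep_eq times_quantum_product.rep_eq uminus_quantum_product.rep_eq)

lemma quantum_product_eqI: "(\<And>n q. component n q s = component n q t) \<Longrightarrow> s = t"
  by (simp add: component_def Rep_quantum_product_inject[symmetric] fun_eq_iff)

text \<open>In the other factors the value is the scalar \<open>e\<close>. Taking \<open>q = 1\<close>, \<open>a = 0\<close>, \<open>b = c = 1\<close> there
  satisfies all relations, hence families that satisfy them in the factor \<open>qalg n q\<close> extend to the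
  whole product.\<close>

lift_definition pad :: "nat \<Rightarrow> complex \<Rightarrow> ncpoly \<Rightarrow> complex \<Rightarrow> quantum_product"
  is "\<lambda>n q p e (n', q').
    if (n', q') \<noteq> (n, q) then cls n' q' (const e)
    else if p \<in> carrier (free_algebra n) then cls n q p else \<zero>\<^bsub>qalg n q\<^esub>"
  by (auto simp: cls_closed free_algebra_const ring.ring_simprules(2)[OF ring_qalg])

lemma component_pad:
  assumes "p \<in> carrier (free_algebra n)"
  shows "component n' q' (pad n q p e) = cls n' q' (if (n', q') = (n, q) then p else const e)"
  using assms by (auto simp: component_def pad.rep_eq)

section \<open>Scalars, monomials and induction on noncommutative polynomials\<close>

lemma const_hom:
  "const (c + d) = const c + const d" "const (c * d) = const c * const d"
  "const (- c) = - const c" "const 0 = 0" "const (c - d) = const c - const d"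
  by (simp_all add: const_def single_add mult_single single_uminus single_diff)

lemma ncpoly_sum_single: "p = (\<Sum>w\<in>Poly_Mapping.keys p. Poly_Mapping.single w (Poly_Mapping.lookup p w))"
  by (rule poly_mapping_eqI)
    (simp add: lookup_sum lookup_single when_def sum.delta in_keys_iff)

text \<open>The monomial case keeps \<open>w\<close> in the support of \<open>p\<close>, because
  membership in \<open>free_algebra n\<close> is a condition on the words that occur.\<close>

lemma ncpoly_single_induct [case_names single add]:
  assumes single: "\<And>w c. w \<in> Poly_Mapping.keys p \<Longrightarrow> P (Poly_Mapping.single w c)"
    and zero: "P 0"
    and add: "\<And>p r. P p \<Longrightarrow> P r \<Longrightarrow> P (p + r)"
  shows "P (p :: ncpoly)"
proof -
  have "P (\<Sum>w\<in>A. Poly_Mapping.single w (Poly_Mapping.lookup p w))"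
    if "finite A" "A \<subseteq> Poly_Mapping.keys p" for A
    using that by (induction A rule: finite_induct) (auto intro: single zero add)
  from this[OF finite_keys subset_refl] show ?thesis
    by (simp only: ncpoly_sum_single[symmetric])
qed

lemma single_Word:
  "Poly_Mapping.single (Word []) c = const c"
  "Poly_Mapping.single (Word (g # gs)) c = var g * Poly_Mapping.single (Word gs) c"
  by (simp_all add: const_def zero_word_def var_def mult_single plus_word_def)

text \<open>A monomial splits letter by letter into a product of variables that ends with its
  coefficient.\<close>

lemma ncpoly_induct [consumes 1, case_names const var add mult]:
  assumes "p \<in> carrier (free_algebra n)"
    and const: "\<And>c. P (const c)"
    and var: "\<And>g. g \<in> gens n \<Longrightarrow> P (var g)"
    and add: "\<And>p r. P p \<Longrightarrow> P r \<Longrightarrow> P (p + r)"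
    and mult: "\<And>p r. P p \<Longrightarrow> P r \<Longrightarrow> P (p * r)"
  shows "P p"
proof (induction p rule: ncpoly_single_induct)
  case (single w c)
  have "P (Poly_Mapping.single (Word gs) c)" if "set gs \<subseteq> gens n" for gs
    using that by (induction gs) (auto simp: single_Word intro: const var mult)
  from this[of "letters w"] single show ?case
    using assms(1) by (auto simp: free_algebra_def)
qed (use const[of 0] add in \<open>auto simp: const_hom\<close>)

lemma const_central: "const c * p = p * const c"
proof (induction p rule: ncpoly_single_induct)
  case (single w d)
  show ?case by (simp add: const_def mult_single mult.commute)
qed (simp_all add: algebra_simps)

lemma pad_hom:
  assumes "p \<in> carrier (free_algebra n)" "r \<in> carrier (free_algebra n)"
  shows "pad n q p d + pad n q r e = pad n q (p + r) (d + e)"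
    "pad n q p d * pad n q r e = pad n q (p * r) (d * e)"
    "- pad n q p d = pad n q (- p) (- d)"
    "pad n q p d - pad n q r e = pad n q (p - r) (d - e)"
proof -
  have uminus: "- pad n q p d = pad n q (- p) (- d)" if "p \<in> carrier (free_algebra n)" for p d
    by (rule quantum_product_eqI)
      (simp add: component_hom component_pad that free_algebra_uminus const_hom cls_uminus free_algebra_const)
  have add: "pad n q p d + pad n q r e = pad n q (p + r) (d + e)" if "r \<in> carrier (free_algebra n)" for r e
    by (rule quantum_product_eqI)
      (simp add: component_hom component_pad assms that free_algebra_add const_hom cls_add free_algebra_const)
  show "pad n q p d * pad n q r e = pad n q (p * r) (d * e)"
    by (rule quantum_product_eqI)
      (simp add: component_hom component_pad assms free_algebra_mult const_hom cls_mult free_algebra_const)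
  show "pad n q p d - pad n q r e = pad n q (p - r) (d - e)"
    using add[of "- r" "- e"] uminus[of r e] assms(2)
    by (simp only: diff_conv_add_uminus free_algebra_uminus)
  show "pad n q p d + pad n q r e = pad n q (p + r) (d + e)" "- pad n q p d = pad n q (- p) (- d)"
    using add uminus assms by simp_all
qed

lemma pad_one: "pad n q 1 1 = 1"
  by (rule quantum_product_eqI)
    (simp add: component_hom component_pad free_algebra_closed(5) const_1 cls_one)

text \<open>Checked factor by factor: every component of the left element is the class of a
  scalar.\<close>

lemma pad_const_central: "pad n q (const c) d * t = t * pad n q (const c) d"
proof (rule quantum_product_eqI)
  fix n' q'
  obtain p where p: "p \<in> carrier (free_algebra n')" "component n' q' t = cls n' q' p"
    using cls_surj[OF component_closed] .
  have "cls n' q' (const e) \<otimes>\<^bsub>qalg n' q'\<^esub> component n' q' t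
      = component n' q' t \<otimes>\<^bsub>qalg n' q'\<^esub> cls n' q' (const e)" for e
    using p by (simp add: cls_mult[symmetric] free_algebra_const const_central)
  then show "component n' q' (pad n q (const c) d * t) = component n' q' (t * pad n q (const c) d)"
    by (cases "(n', q') = (n, q)") (simp_all add: component_hom component_pad free_algebra_const, blast)
qed

lemma pad_eqI:
  assumes "p - r \<in> relators n q" "p \<in> carrier (free_algebra n)" "r \<in> carrier (free_algebra n)"
  shows "pad n q p e = pad n q r e"
  by (rule quantum_product_eqI) (simp add: component_pad assms(2,3) cls_eqI[OF assms])

section \<open>Substitution and homomorphisms out of the quotient\<close>

definition substitute :: "(gen \<Rightarrow> ncpoly) \<Rightarrow> ncpoly \<Rightarrow> ncpoly" where
  "substitute \<sigma> p = (\<Sum>w\<in>Poly_Mapping.keys p. const (Poly_Mapping.lookup p w) * prod_list (map \<sigma> (letters w)))"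

text \<open>Brings sums over different supports to one common index set; the added words have
  coefficient 0.\<close>

lemma substitute_superset:
  assumes "finite A" "Poly_Mapping.keys p \<subseteq> A"
  shows "substitute \<sigma> p = (\<Sum>w\<in>A. const (Poly_Mapping.lookup p w) * prod_list (map \<sigma> (letters w)))"
  unfolding substitute_def using assms
  by (intro sum.mono_neutral_left) (auto simp: in_keys_iff const_hom)

lemma substitute_add: "substitute \<sigma> (p + r) = substitute \<sigma> p + substitute \<sigma> r"
proof -
  let ?A = "Poly_Mapping.keys p \<union> Poly_Mapping.keys r"
  have "Poly_Mapping.keys (p + r) \<subseteq> ?A"
    by (rule Poly_Mapping.keys_add)
  then show ?thesis
    by (simp add: substitute_superset[of ?A] lookup_add const_hom distrib_right sum.distrib)
qed

lemma substitute_single: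
  "substitute \<sigma> (Poly_Mapping.single w c) = const c * prod_list (map \<sigma> (letters w))"
  using substitute_superset[of "{w}"] by simp

lemma substitute_const: "substitute \<sigma> (const c) = const c"
  by (subst const_def) (simp add: substitute_single zero_word_def)

lemma substitute_var: "substitute \<sigma> (var g) = \<sigma> g"
  by (simp add: var_def substitute_single const_1)

lemma substitute_mult: "substitute \<sigma> (p * r) = substitute \<sigma> p * substitute \<sigma> r"
proof (induction p rule: ncpoly_single_induct)
  case (single v c)
  show ?case
  proof (induction r rule: ncpoly_single_induct)
    case (single w d)
    let ?x = "prod_list (map \<sigma> (letters v))" and ?y = "prod_list (map \<sigma> (letters w))"
    have "const c * ?x * (const d * ?y) = const c * (?x * const d) * ?y"
      by (simp only: mult.assoc)
    also have "\<dots> = const c * const d * (?x * ?y)"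
      unfolding const_central[of d ?x, symmetric] by (simp only: mult.assoc)
    finally show ?case
      by (simp add: mult_single substitute_single plus_word_def const_hom(2))
  qed (simp_all add: substitute_def[of _ 0] substitute_add distrib_left)
qed (simp_all add: substitute_def[of _ 0] substitute_add distrib_right)

lemma substitute_closed:
  assumes "p \<in> carrier (free_algebra n)" "\<And>g. g \<in> gens n \<Longrightarrow> \<sigma> g \<in> carrier (free_algebra n)"
  shows "substitute \<sigma> p \<in> carrier (free_algebra n)"
  using assms(1)
  by (induction p rule: ncpoly_induct)
    (auto simp: substitute_const substitute_var substitute_add substitute_mult
      intro: assms(2) free_algebra_closed)

lemma cls_substitute_ring_hom:
  assumes "\<And>g. g \<in> gens n \<Longrightarrow> \<sigma> g \<in> carrier (free_algebra n)"
  shows "(\<lambda>p. cls n q (substitute \<sigma> p)) \<in> ring_hom (free_algebra n) (qalg n q)"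
  using assms substitute_const[of \<sigma> 1]
  by (intro ring_hom_memI)
    (simp_all add: substitute_closed cls_closed free_algebra_ops substitute_mult cls_mult
      substitute_add cls_add const_1 cls_one)

text \<open>The universal property of the quotient: the kernel of \<open>h\<close> is an ideal
  containing the relators, hence it contains the ideal they generate.\<close>

lemma qalg_hom_lift:
  assumes hom: "h \<in> ring_hom (free_algebra n) (qalg n q)"
    and rel: "\<And>r. r \<in> relators n q \<Longrightarrow> h r = \<zero>\<^bsub>qalg n q\<^esub>"
  obtains f where "f \<in> ring_hom (qalg n q) (qalg n q)" "f \<in> extensional (carrier (qalg n q))"
    "\<And>p. p \<in> carrier (free_algebra n) \<Longrightarrow> f (cls n q p) = h p"
proof -
  note ideal_kernel = ring_hom_ring.kernel_is_ideal[OF ring_hom_ringI2[OF ring_free_algebra ring_qalg hom]]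
  have "rel_ideal n q \<subseteq> a_kernel (free_algebra n) (qalg n q) h"
    unfolding rel_ideal_def using rel relators_subset[of n q]
    by (intro ring.genideal_minimal[OF ring_free_algebra] ideal_kernel) (auto simp: a_kernel_def')
  then have ker: "h p = \<zero>\<^bsub>qalg n q\<^esub>" if "p \<in> rel_ideal n q" for p
    using that by (auto simp: a_kernel_def')
  have eq: "h p = h r"
    if "cls n q p = cls n q r" "p \<in> carrier (free_algebra n)" "r \<in> carrier (free_algebra n)" for p r
  proof -
    have "h (p - r) = \<zero>\<^bsub>qalg n q\<^esub>"
      using that by (simp add: cls_eq_iff ker)
    moreover have "h p = h (p - r) \<oplus>\<^bsub>qalg n q\<^esub> h r"
      using that ring_hom_add[OF hom, of "p - r" r] by (simp add: free_algebra_ops free_algebra_minus)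
    ultimately show ?thesis
      using that by (simp add: ring.ring_simprules(8)[OF ring_qalg] ring_hom_closed[OF hom])
  qed
  \<comment> \<open>The value is computed on a chosen representative, which is harmless by
    \<open>eq\<close>; the restriction to the carrier makes \<open>f\<close> extensional.\<close>
  define f where "f = (\<lambda>x\<in>carrier (qalg n q). h (SOME p. p \<in> carrier (free_algebra n) \<and> cls n q p = x))"
  have f: "f (cls n q p) = h p" if p: "p \<in> carrier (free_algebra n)" for p
  proof -
    let ?r = "SOME r. r \<in> carrier (free_algebra n) \<and> cls n q r = cls n q p"
    have "?r \<in> carrier (free_algebra n) \<and> cls n q ?r = cls n q p"
      by (rule someI[of _ p]) (simp add: p)
    then show ?thesis
      by (simp add: f_def cls_closed p eq[of ?r p])
  qed
  have "f \<in> ring_hom (qalg n q) (qalg n q)"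
  proof (rule ring_hom_memI)
    fix x y assume "x \<in> carrier (qalg n q)" "y \<in> carrier (qalg n q)"
    then obtain p r where "p \<in> carrier (free_algebra n)" "x = cls n q p"
      "r \<in> carrier (free_algebra n)" "y = cls n q r"
      by (elim cls_surj)
    then show "f x \<in> carrier (qalg n q)"
      "f (x \<otimes>\<^bsub>qalg n q\<^esub> y) = f x \<otimes>\<^bsub>qalg n q\<^esub> f y"
      "f (x \<oplus>\<^bsub>qalg n q\<^esub> y) = f x \<oplus>\<^bsub>qalg n q\<^esub> f y"
      using ring_hom_mult[OF hom, of p r] ring_hom_add[OF hom, of p r] ring_hom_closed[OF hom, of p]
      by (simp_all add: f cls_mult[symmetric] cls_add[symmetric] free_algebra_closed free_algebra_ops)
  next
    show "f \<one>\<^bsub>qalg n q\<^esub> = \<one>\<^bsub>qalg n q\<^esub>"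
      using f[of 1] ring_hom_one[OF hom] by (simp add: cls_one free_algebra_closed free_algebra_ops)
  qed
  then show ?thesis
    using f by (intro that[of f]) (auto simp: f_def)
qed

section \<open>Braid automorphisms\<close>

lemma relators_node:
  assumes "i \<in> {1..n - 1}"
  defines "a \<equiv> var (Gen_a i)" and "b \<equiv> var (Gen_b i)" and "c \<equiv> var (Gen_c i)"
  shows "const q * a * b - const (1 / q) * b * a \<in> relators n q"
    "const (1 / q) * a * c - const q * c * a \<in> relators n q"
    "(b * c - c * b) - const (q\<^sup>2 - 1 / q\<^sup>2) * (a * a) \<in> relators n q"
    "b * c - (const (q\<^sup>2) * (a * a) + 1) \<in> relators n q"
  using assms(1) unfolding relators_def Let_def a_def b_def c_def
  by (simp_all only: power2_eq_square[of "var g" for g]) blast+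

lemma relators_link:
  assumes "i \<in> {1..n - 1}" "j \<in> {i<..n - 1}"
  defines "a \<equiv> var (Gen_a i)" and "b \<equiv> var (Gen_b i)" and "c \<equiv> var (Gen_c i)"
    and "a' \<equiv> var (Gen_a j)" and "b' \<equiv> var (Gen_b j)" and "c' \<equiv> var (Gen_c j)"
  shows "const (1 / q) * b * b' - const q * b' * b \<in> relators n q"
    "const (1 / q) * c * c' - const q * c' * c \<in> relators n q"
    "a * b' - b' * a \<in> relators n q"
    "c * a' - a' * c \<in> relators n q"
    "const q * c * b' - const (1 / q) * b' * c \<in> relators n q"
    "b * a' - (a' * b + const (q\<^sup>2 - 1 / q\<^sup>2) * a * b') \<in> relators n q"
    "a * c' - (c' * a + const (q\<^sup>2 - 1 / q\<^sup>2) * c * a') \<in> relators n q"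
    "a * a' - (a' * a + const (1 - 1 / q\<^sup>2) * b' * c) \<in> relators n q"
    "a * a' - (a' * a + const (q\<^sup>2 - 1) * c * b') \<in> relators n q"
    "(const q * b * c' + const (q * (1 / q\<^sup>2 - q\<^sup>2)) * a * a')
      - (const (1 / q) * c' * b - const (1 / q * (1 / q\<^sup>2 - q\<^sup>2)) * a' * a) \<in> relators n q"
  using assms(1,2) unfolding relators_def Let_def a_def b_def c_def a'_def b'_def c'_def
  by blast+

lemma gens_closed:
  assumes "i \<in> {1..n - 1}"
  shows "var (Gen_a i) \<in> carrier (free_algebra n)" "var (Gen_b i) \<in> carrier (free_algebra n)"
    "var (Gen_c i) \<in> carrier (free_algebra n)"
  using assms by (auto simp: gens_def intro!: free_algebra_var)

lemma qalg_hom_uminus: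
  assumes "f \<in> ring_hom (qalg n q) (qalg n q)" "x \<in> carrier (qalg n q)"
  shows "f (\<ominus>\<^bsub>qalg n q\<^esub> x) = \<ominus>\<^bsub>qalg n q\<^esub> f x"
proof (rule sym, rule abelian_group.minus_equality)
  show "abelian_group (qalg n q)"
    by (rule ring.is_abelian_group[OF ring_qalg])
  have minus: "\<ominus>\<^bsub>qalg n q\<^esub> x \<in> carrier (qalg n q)"
    by (rule ring.ring_simprules(3)[OF ring_qalg assms(2)])
  show "f (\<ominus>\<^bsub>qalg n q\<^esub> x) \<oplus>\<^bsub>qalg n q\<^esub> f x = \<zero>\<^bsub>qalg n q\<^esub>"
    using ring_hom_add[OF assms(1) minus assms(2)] ring.ring_simprules(9)[OF ring_qalg assms(2)]
      ring_hom_zero[OF assms(1) ring_qalg ring_qalg] by simp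
  show "f x \<in> carrier (qalg n q)" "f (\<ominus>\<^bsub>qalg n q\<^esub> x) \<in> carrier (qalg n q)"
    using assms minus by (auto intro: ring_hom_closed)
qed

section \<open>The generators inside the product ring\<close>

locale quantum_algebra =
  fixes n :: nat and q :: complex
  assumes q_nonzero: "q \<noteq> 0"
begin

abbreviation Q :: quantum_product where "Q \<equiv> pad n q (const q) 1"
abbreviation P :: quantum_product where "P \<equiv> pad n q (const (1 / q)) 1"

sublocale quantum_parameter Q P
proof
  show "Q * x = x * Q" for x
    by (rule pad_const_central)
  show "Q * P = 1"
    using q_nonzero pad_one by (simp add: pad_hom free_algebra_const const_hom(2)[symmetric] const_1)
qed

text \<open>The last argument is the value in the other factors. There \<open>q\<close> is 1, so
  \<open>q\<^sup>2\<close> becomes 1 and all the differences become 0.\<close>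

lemma pad_coeff:
  "Q * Q = pad n q (const (q\<^sup>2)) 1"
  "Q * Q - P * P = pad n q (const (q\<^sup>2 - 1 / q\<^sup>2)) 0"
  "1 - P * P = pad n q (const (1 - 1 / q\<^sup>2)) 0"
  "Q * Q - 1 = pad n q (const (q\<^sup>2 - 1)) 0"
  "Q * (P * P - Q * Q) = pad n q (const (q * (1 / q\<^sup>2 - q\<^sup>2))) 0"
  "P * (P * P - Q * Q) = pad n q (const (1 / q * (1 / q\<^sup>2 - q\<^sup>2))) 0"
proof -
  have QQ: "Q * Q = pad n q (const (q\<^sup>2)) 1" and PP: "P * P = pad n q (const (1 / q\<^sup>2)) 1"
    by (simp_all add: pad_hom free_algebra_const const_hom(2)[symmetric] power2_eq_square)
  have one: "1 = pad n q (const 1) 1"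
    by (simp add: pad_one const_1)
  show "Q * Q = pad n q (const (q\<^sup>2)) 1"
    by (fact QQ)
  show "Q * Q - P * P = pad n q (const (q\<^sup>2 - 1 / q\<^sup>2)) 0" "1 - P * P = pad n q (const (1 - 1 / q\<^sup>2)) 0"
    "Q * Q - 1 = pad n q (const (q\<^sup>2 - 1)) 0"
    "Q * (P * P - Q * Q) = pad n q (const (q * (1 / q\<^sup>2 - q\<^sup>2))) 0"
    "P * (P * P - Q * Q) = pad n q (const (1 / q * (1 / q\<^sup>2 - q\<^sup>2))) 0"
    unfolding QQ PP one
    by (simp_all only: pad_hom free_algebra_const const_hom(2,5)[symmetric]) simp_all
qed

definition gen_a where "gen_a i = pad n q (var (Gen_a i)) 0"
definition gen_b where "gen_b i = pad n q (var (Gen_b i)) 1"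
definition gen_c where "gen_c i = pad n q (var (Gen_c i)) 1"
definition gen_mat where "gen_mat i = monodromy (gen_a i) (gen_b i) (gen_c i)"

lemma pad_eqI':
  assumes "p - r \<in> relators n q" "p \<in> carrier (free_algebra n)" "r \<in> carrier (free_algebra n)" "d = e"
  shows "pad n q p d = pad n q r e"
  using assms pad_eqI by simp

lemma node_gen:
  assumes "i \<in> {1..n - 1}"
  shows "node (gen_a i) (gen_b i) (gen_c i)"
  \<comment> \<open>The differences are replaced first: rewriting \<open>Q * Q\<close> earlier would
    hide them from their equations.\<close>
  unfolding node_def pad_coeff(2-)
  unfolding pad_coeff(1) gen_a_def gen_b_def gen_c_def pad_one[of n q, symmetric]
  by (simp only: pad_hom free_algebra_closed gens_closed[OF assms],
      intro conjI relators_node[OF assms, THEN pad_eqI'])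
    (simp_all add: free_algebra_closed gens_closed[OF assms])

lemma link_gen:
  assumes "i \<in> {1..n - 1}" "j \<in> {i<..n - 1}"
  shows "link (gen_a i) (gen_b i) (gen_c i) (gen_a j) (gen_b j) (gen_c j)"
proof -
  have j: "j \<in> {1..n - 1}" using assms by auto
  note closed = free_algebra_closed gens_closed[OF assms(1)] gens_closed[OF j]
  show ?thesis
    unfolding link_def pad_coeff(2-) gen_a_def gen_b_def gen_c_def
    by (simp only: pad_hom closed, intro conjI relators_link[OF assms, THEN pad_eqI'])
      (simp_all add: closed)
qed

lemma consistent_gen_mat: "consistent (n - 1) gen_mat"
  unfolding consistent_def gen_mat_def admissible_iff link_iff[symmetric]
  using node_gen link_gen by blast

section \<open>Endomorphisms from consistent families\<close>

lemma component_scale: "component n q (Q * t) = scale n q q (component n q t)"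
  "component n q (P * t) = scale n q (1 / q) (component n q t)"
  by (simp_all add: component_hom component_pad free_algebra_const scale_def)

lemma component_gen:
  assumes "i \<in> {1..n - 1}"
  shows "component n q (gen_a i) = cls n q (var (Gen_a i))"
    "component n q (gen_b i) = cls n q (var (Gen_b i))"
    "component n q (gen_c i) = cls n q (var (Gen_c i))"
  using gens_closed[OF assms] by (simp_all add: component_pad gen_a_def gen_b_def gen_c_def)

lemma component_gen_mat:
  "i \<in> {1..n - 1} \<Longrightarrow> map_mat2 (component n q) (gen_mat i) = monodromy_mat n q i"
  by (simp add: gen_mat_def monodromy_def monodromy_mat_def component_hom(3) component_scale component_gen Let_def)

lemma component_mat_mult:
  "map_mat2 (component n q) (X * Y) =
    mat2_mult (qalg n q) (map_mat2 (component n q) X) (map_mat2 (component n q) Y)"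
  by (cases X; cases Y) (simp add: component_hom)

lemma component_mat_uminus:
  "map_mat2 (component n q) (- X) = mat2_uminus (qalg n q) (map_mat2 (component n q) X)"
  by (cases X) (simp add: component_hom mat2_uminus_def)

text \<open>The entries of the matrices \<open>M j\<close> satisfy all relations in the product,
  hence their components do so in \<open>qalg n q\<close>. Substituting them for the generators
  therefore factors through the quotient.\<close>

lemma alg_end_exists:
  assumes "consistent (n - 1) M"
  obtains f where "f \<in> alg_end n q" "f \<in> extensional (carrier (qalg n q))"
    "\<And>j. j \<in> {1..n - 1} \<Longrightarrow>
      map_mat2 f (monodromy_mat n q j) = map_mat2 (component n q) (M j)"
proof -
  have "\<forall>j. \<exists>a b c. j \<in> {1..n - 1} \<longrightarrow> M j = monodromy a b c \<and> node a b c"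
    using assms unfolding consistent_def admissible_iff by blast
  then obtain a b c where M: "\<And>j. j \<in> {1..n - 1} \<Longrightarrow> M j = monodromy (a j) (b j) (c j)"
    and node: "\<And>j. j \<in> {1..n - 1} \<Longrightarrow> node (a j) (b j) (c j)"
    by metis
  have link: "link (a i) (b i) (c i) (a j) (b j) (c j)" if "i \<in> {1..n - 1}" "j \<in> {i<..n - 1}" for i j
  proof -
    have "linked (M i) (M j)" "j \<in> {1..n - 1}"
      using assms that by (auto simp: consistent_def)
    then show ?thesis
      using that by (simp only: M link_iff)
  qed
  define v where "v g = (case g of Gen_a i \<Rightarrow> a i | Gen_b i \<Rightarrow> b i | Gen_c i \<Rightarrow> c i)" for g
  \<comment> \<open>Substitution works with polynomials, so representatives of the desired images
    are chosen first.\<close>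
  have "\<exists>p. p \<in> carrier (free_algebra n) \<and> cls n q p = component n q (v g)" for g
    using cls_surj[OF component_closed] by metis
  then obtain \<sigma> where \<sigma>: "\<And>g. \<sigma> g \<in> carrier (free_algebra n)"
    "\<And>g. cls n q (\<sigma> g) = component n q (v g)"
    by metis
  define h where "h p = cls n q (substitute \<sigma> p)" for p
  have hom: "h \<in> ring_hom (free_algebra n) (qalg n q)"
    using cls_substitute_ring_hom[of n \<sigma> q] \<sigma>(1) unfolding h_def .
  \<comment> \<open>Pairs an element of the product with a polynomial whose image under
    \<open>h\<close> is its component. As this is compatible with the ring operations, a relation
    that holds in the product makes \<open>h\<close> vanish on its relator.\<close>
  define represents where
    "represents t p \<longleftrightarrow> p \<in> carrier (free_algebra n) \<and> h p = component n q t" for t p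
  have rep_var: "represents (a i) (var (Gen_a i))" "represents (b i) (var (Gen_b i))"
    "represents (c i) (var (Gen_c i))" if "i \<in> {1..n - 1}" for i
    using gens_closed[OF that] \<sigma>(2) by (simp_all add: represents_def h_def substitute_var v_def)
  have rep_const: "represents (pad n q (const z) e) (const z)" for z e
    by (simp add: represents_def h_def substitute_const component_pad free_algebra_const)
  have rep_mult: "represents (s * t) (p * r)" and rep_add: "represents (s + t) (p + r)"
    if "represents s p" "represents t r" for s t p r
    using that ring_hom_mult[OF hom, of p r] ring_hom_add[OF hom, of p r]
    by (simp_all add: represents_def free_algebra_ops free_algebra_closed component_hom)
  have rep_uminus: "represents (- t) (- p)" if "represents t p" for t p
  proof -
    have "pad n q (const (- 1)) (- 1) = - 1"
      using pad_hom(3)[of 1 n 1 q 1] by (simp add: const_hom const_1 free_algebra_closed pad_one)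
    then show ?thesis
      using rep_mult[OF rep_const[of "- 1" "- 1"] that] by (simp add: const_hom const_1)
  qed
  have rep_diff: "represents (s - t) (p - r)" if "represents s p" "represents t r" for s t p r
    using rep_add[OF that(1) rep_uminus[OF that(2)]] by simp
  have rep_one: "represents 1 1"
    using rep_const[of 1 1] by (simp add: const_1 pad_one)
  have rep_coeff: "represents (Q * Q) (const (q\<^sup>2))" "represents (Q * Q - P * P) (const (q\<^sup>2 - 1 / q\<^sup>2))"
    "represents (1 - P * P) (const (1 - 1 / q\<^sup>2))" "represents (Q * Q - 1) (const (q\<^sup>2 - 1))"
    "represents (Q * (P * P - Q * Q)) (const (q * (1 / q\<^sup>2 - q\<^sup>2)))"
    "represents (P * (P * P - Q * Q)) (const (1 / q * (1 / q\<^sup>2 - q\<^sup>2)))"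
    unfolding pad_coeff(2-) by (simp_all add: rep_const pad_coeff(1))
  have vanish: "h (p - r) = \<zero>\<^bsub>qalg n q\<^esub>" if "represents s p" "represents t r" "s = t" for s t p r
    using rep_diff[OF that(1,2)] that(3) by (simp add: represents_def component_hom)
  have "h r = \<zero>\<^bsub>qalg n q\<^esub>" if r: "r \<in> relators n q" for r
    using r unfolding relators_def Let_def power2_eq_square[of "var g" for g]
  proof (elim UnE UN_E, goal_cases)
    case (1 i)
    note rep = rep_coeff rep_one rep_const[of q 1] rep_const[of "1 / q" 1] rep_var[OF 1(1)] rep_mult rep_add rep_diff
    show ?case
      using 1(2) node[OF 1(1), unfolded node_def]
      \<comment> \<open>The \<open>represents\<close> goals are solved along the syntax of both
        sides, which determines \<open>s\<close> and \<open>t\<close>; compound scalars are tried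
        before general products. The equation that remains is the matching conjunct of
        \<open>node\<close>.\<close>
      by (elim insertE emptyE conjE) (hypsubst, rule vanish, (rule rep)+, assumption)+
  next
    case (2 i j)
    then have j: "j \<in> {1..n - 1}" by auto
    note rep = rep_coeff rep_one rep_const[of q 1] rep_const[of "1 / q" 1] rep_var[OF 2(1)] rep_var[OF j] rep_mult rep_add rep_diff
    show ?case
      using 2(3) link[OF 2(1,2), unfolded link_def]
      by (elim insertE emptyE conjE) (hypsubst, rule vanish, (rule rep)+, assumption)+
  qed
  then obtain f where f: "f \<in> ring_hom (qalg n q) (qalg n q)" "f \<in> extensional (carrier (qalg n q))"
    "\<And>p. p \<in> carrier (free_algebra n) \<Longrightarrow> f (cls n q p) = h p"
    using qalg_hom_lift[OF hom] by metis
  have scale: "f (scale n q z x) = scale n q z (f x)" if "x \<in> carrier (qalg n q)" for z x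
    using that ring_hom_mult[OF f(1), of "cls n q (const z)" x] f(3)[of "const z"]
    by (simp add: scale_def cls_closed free_algebra_const h_def substitute_const)
  then have "f \<in> alg_end n q"
    using f(1) by (simp add: alg_end_def)
  moreover have "map_mat2 f (monodromy_mat n q j) = map_mat2 (component n q) (M j)"
    if j: "j \<in> {1..n - 1}" for j
  proof -
    have "f (component n q (gen_a j)) = component n q (a j)" "f (component n q (gen_b j)) = component n q (b j)"
      "f (component n q (gen_c j)) = component n q (c j)"
      using rep_var[OF j] by (simp_all add: represents_def component_gen[OF j] f(3))
    moreover have "f (\<ominus>\<^bsub>qalg n q\<^esub> x) = \<ominus>\<^bsub>qalg n q\<^esub> f x" if "x \<in> carrier (qalg n q)" for x
      using qalg_hom_uminus[OF f(1) that] .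
    ultimately show ?thesis
      unfolding component_gen_mat[OF j, symmetric] M[OF j] gen_mat_def monodromy_def
      using component_closed[of n q "P * gen_a j"]
      by (simp add: component_hom(3) component_scale scale component_closed)
  qed
  ultimately show ?thesis
    using f(2) that by blast
qed

text \<open>The matrices determine the generators: \<open>c\<close> is an entry, \<open>b\<close> is
  recovered by negation and \<open>a\<close> by undoing the scaling with \<open>q\<close>. Linearity
  fixes the constants, and induction on polynomials reaches every class.\<close>

lemma alg_end_eqI:
  assumes fg: "f \<in> alg_end n q" "g \<in> alg_end n q"
    and eq: "\<And>j. j \<in> {1..n - 1} \<Longrightarrow> map_mat2 f (monodromy_mat n q j) = map_mat2 g (monodromy_mat n q j)"
    and x: "x \<in> carrier (qalg n q)"
  shows "f x = g x"
proof -
  have hom: "f \<in> ring_hom (qalg n q) (qalg n q)" "g \<in> ring_hom (qalg n q) (qalg n q)"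
    and scale: "\<And>z x. x \<in> carrier (qalg n q) \<Longrightarrow> f (scale n q z x) = scale n q z (f x)"
      "\<And>z x. x \<in> carrier (qalg n q) \<Longrightarrow> g (scale n q z x) = scale n q z (g x)"
    using fg by (auto simp: alg_end_def)
  have unscale: "scale n q (1 / q) (scale n q q x) = x" if x: "x \<in> carrier (qalg n q)" for x
  proof -
    obtain p where p: "p \<in> carrier (free_algebra n)" "x = cls n q p"
      using cls_surj[OF x] .
    have "scale n q (1 / q) (scale n q q x) = cls n q (const (1 / q) * (const q * p))"
      by (simp only: scale_def p cls_mult free_algebra_closed)
    also have "\<dots> = x"
      using q_nonzero p(2)
      by (simp add: mult.assoc[symmetric] const_hom(2)[symmetric] const_1)
    finally show ?thesis .
  qed
  have const: "f (cls n q (const z)) = g (cls n q (const z))" for z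
  proof -
    have "cls n q (const z) = scale n q z (cls n q 1)"
      by (simp add: scale_def cls_mult[symmetric] free_algebra_closed)
    then show ?thesis
      using scale[of "cls n q 1" z] ring_hom_one[OF hom(1)] ring_hom_one[OF hom(2)]
      by (simp add: cls_one ring.ring_simprules(6)[OF ring_qalg])
  qed
  have var: "f (cls n q (var e)) = g (cls n q (var e))" if e: "e \<in> gens n" for e
  proof -
    obtain j where j: "j \<in> {1..n - 1}" "e = Gen_a j \<or> e = Gen_b j \<or> e = Gen_c j"
      using e by (auto simp: gens_def)
    note closed = gens_closed[OF j(1), THEN cls_closed, of q]
    have "scale n q q (f (cls n q (var (Gen_a j)))) = scale n q q (g (cls n q (var (Gen_a j))))"
      "\<ominus>\<^bsub>qalg n q\<^esub> f (cls n q (var (Gen_b j))) = \<ominus>\<^bsub>qalg n q\<^esub> g (cls n q (var (Gen_b j)))"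
      "f (cls n q (var (Gen_c j))) = g (cls n q (var (Gen_c j)))"
      using eq[OF j(1)] closed scale(1)[of "cls n q (var (Gen_a j))" q] scale(2)[of "cls n q (var (Gen_a j))" q]
      by (simp_all add: monodromy_mat_def Let_def qalg_hom_uminus[OF hom(1)] qalg_hom_uminus[OF hom(2)])
    note eqs = this
    have "f (cls n q (var (Gen_a j))) = g (cls n q (var (Gen_a j)))"
      using arg_cong[OF eqs(1), of "scale n q (1 / q)"] closed(1)
      by (simp only: unscale hom[THEN ring_hom_closed])
    moreover have "f (cls n q (var (Gen_b j))) = g (cls n q (var (Gen_b j)))"
      using arg_cong[OF eqs(2), of "\<lambda>x. \<ominus>\<^bsub>qalg n q\<^esub> x"] closed(2)
      by (simp only: ring.ring_simprules(20)[OF ring_qalg] hom[THEN ring_hom_closed])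
    moreover note eqs(3)
    ultimately show ?thesis using j(2) by auto
  qed
  obtain p where p: "p \<in> carrier (free_algebra n)" "x = cls n q p"
    using cls_surj[OF x] .
  have "p \<in> carrier (free_algebra n) \<and> f (cls n q p) = g (cls n q p)"
    using p(1)
  proof (induction p rule: ncpoly_induct)
    case (const z)
    then show ?case using \<open>f (cls n q (const z)) = g (cls n q (const z))\<close> by (simp add: free_algebra_const)
  next
    case (var e)
    then show ?case using \<open>e \<in> gens n \<Longrightarrow> f (cls n q (var e)) = g (cls n q (var e))\<close> by (simp add: free_algebra_var)
  next
    case (add p r)
    then show ?case
      using ring_hom_add[OF hom(1)] ring_hom_add[OF hom(2)] by (simp add: cls_add cls_closed free_algebra_closed)
  next
    case (mult p r)
    then show ?case
      using ring_hom_mult[OF hom(1)] ring_hom_mult[OF hom(2)] by (simp add: cls_mult cls_closed free_algebra_closed)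
  qed
  then show ?thesis
    using p(2) by simp
qed

text \<open>An endomorphism acts on \<open>qalg n q\<close> and not on the product type. Passing
  through \<open>component n q\<close> lets its action be computed with words in the ring of
  matrices.\<close>

definition sends :: "(ncpoly set \<Rightarrow> ncpoly set) \<Rightarrow> quantum_product mat2 \<Rightarrow> quantum_product mat2 \<Rightarrow> bool" where
  "sends f X Y \<longleftrightarrow> map_mat2 f (map_mat2 (component n q) X) = map_mat2 (component n q) Y"

lemma sends_mult:
  assumes "f \<in> alg_end n q" "sends f X X'" "sends f Y Y'"
  shows "sends f (X * Y) (X' * Y')"
proof -
  have hom: "f \<in> ring_hom (qalg n q) (qalg n q)"
    using assms(1) by (simp add: alg_end_def)
  show ?thesis
    using assms(2,3) ring_hom_mult[OF hom] ring_hom_add[OF hom]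
    by (cases X; cases Y; cases X'; cases Y')
      (simp add: sends_def component_hom component_closed ring.ring_simprules(5)[OF ring_qalg])
qed

lemma sends_uminus:
  assumes "f \<in> alg_end n q" "sends f X X'"
  shows "sends f (- X) (- X')"
proof -
  have hom: "f \<in> ring_hom (qalg n q) (qalg n q)"
    using assms(1) by (simp add: alg_end_def)
  show ?thesis
    using assms(2) qalg_hom_uminus[OF hom]
    by (cases X; cases X') (simp add: sends_def component_hom component_closed)
qed

lemma sends_comp: "sends f X Y \<Longrightarrow> sends g Y Z \<Longrightarrow> sends (g \<circ> f) X Z"
  by (cases X; cases Y; cases Z) (simp add: sends_def)

lemma alg_end_closed: "f \<in> alg_end n q \<Longrightarrow> x \<in> carrier (qalg n q) \<Longrightarrow> f x \<in> carrier (qalg n q)"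
  by (auto simp: alg_end_def dest: ring_hom_closed)

lemma alg_end_comp:
  assumes "f \<in> alg_end n q" "g \<in> alg_end n q"
  shows "g \<circ> f \<in> alg_end n q"
  using assms alg_end_closed[OF assms(1)] ring_hom_trans[of f "qalg n q" "qalg n q" g "qalg n q"]
  by (simp add: alg_end_def)

lemma id_alg_end: "id \<in> alg_end n q"
  by (auto simp: alg_end_def ring_hom_def)

lemma sends_eqI:
  assumes "f \<in> alg_end n q" "g \<in> alg_end n q"
    "\<And>j. j \<in> {1..n - 1} \<Longrightarrow> \<exists>Y. sends f (gen_mat j) Y \<and> sends g (gen_mat j) Y"
    "x \<in> carrier (qalg n q)"
  shows "f x = g x"
  by (rule alg_end_eqI[OF assms(1,2) _ assms(4)]) (use assms(3) in \<open>force simp: sends_def component_gen_mat\<close>)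

section \<open>The braid transformations, their inverses and the braid relation\<close>

lemma braid_image_eq:
  assumes "1 \<le> i" "i + 1 \<le> n - 1" "j \<in> {1..n - 1}"
  shows "braid_image n q i j = map_mat2 (component n q) (braid i gen_mat j)"
  using assms
  by (simp add: braid_image_def braid_def component_mat_mult component_mat_uminus component_gen_mat)

lemma is_beta_iff:
  assumes "1 \<le> i" "i + 1 \<le> n - 1"
  shows "is_beta n q i f \<longleftrightarrow> f \<in> alg_end n q \<and> f \<in> extensional (carrier (qalg n q)) \<and>
    (\<forall>j\<in>{1..n - 1}. sends f (gen_mat j) (braid i gen_mat j))"
  using assms unfolding is_beta_def sends_def
  by (simp add: braid_image_eq component_gen_mat)

lemma gen_mat_square: "j \<in> {1..n - 1} \<Longrightarrow> gen_mat j * gen_mat j = - 1"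
  using consistent_gen_mat by (auto simp: consistent_def admissible_def)

lemma gen_mat_cancel: "j \<in> {1..n - 1} \<Longrightarrow> gen_mat j * (gen_mat j * X) = - X"
  by (simp add: mult.assoc[symmetric] gen_mat_square)

text \<open>Existence comes from consistency of the braided family; two candidates agree on all
  matrices, hence on the carrier, and extensionality does the rest.\<close>

lemma ex1_beta:
  assumes "1 \<le> i" "i + 1 \<le> n - 1"
  shows "\<exists>!f. is_beta n q i f"
proof (rule ex_ex1I)
  obtain f where "f \<in> alg_end n q" "f \<in> extensional (carrier (qalg n q))"
    "\<And>j. j \<in> {1..n - 1} \<Longrightarrow> sends f (gen_mat j) (braid i gen_mat j)"
    using alg_end_exists[OF consistent_braid(1)[OF consistent_gen_mat, of i]] assms
    by (auto simp: sends_def component_gen_mat)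
  then show "\<exists>f. is_beta n q i f"
    unfolding is_beta_iff[OF assms] by blast
next
  fix f g assume "is_beta n q i f" "is_beta n q i g"
  then have f: "f \<in> alg_end n q" "f \<in> extensional (carrier (qalg n q))"
      "\<And>j. j \<in> {1..n - 1} \<Longrightarrow> sends f (gen_mat j) (braid i gen_mat j)"
    and g: "g \<in> alg_end n q" "g \<in> extensional (carrier (qalg n q))"
      "\<And>j. j \<in> {1..n - 1} \<Longrightarrow> sends g (gen_mat j) (braid i gen_mat j)"
    unfolding is_beta_iff[OF assms] by blast+
  show "f = g"
    using f(2) g(2) by (rule extensionalityI) (rule sends_eqI[OF f(1) g(1)], use f(3) g(3) in blast)
qed

text \<open>The endomorphism \<open>g\<close> obtained from \<open>braid_inv\<close> is a two-sided
  inverse on the carrier, since both composites fix every \<open>gen_mat j\<close>.\<close>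

lemma beta_alg_aut:
  assumes "1 \<le> i" "i + 1 \<le> n - 1" "is_beta n q i f"
  shows "f \<in> alg_aut n q"
proof -
  have f: "f \<in> alg_end n q" "\<And>j. j \<in> {1..n - 1} \<Longrightarrow> sends f (gen_mat j) (braid i gen_mat j)"
    using assms(3) unfolding is_beta_iff[OF assms(1,2)] by blast+
  obtain g where g: "g \<in> alg_end n q"
    "\<And>j. j \<in> {1..n - 1} \<Longrightarrow> sends g (gen_mat j) (braid_inv i gen_mat j)"
    using alg_end_exists[OF consistent_braid(2)[OF consistent_gen_mat, of i]] assms
    by (auto simp: sends_def component_gen_mat)
  have i: "i \<in> {1..n - 1}" "i + 1 \<in> {1..n - 1}"
    using assms by auto
  note square = gen_mat_square[OF i(1)] gen_mat_square[OF i(2)] gen_mat_cancel[OF i(1)]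
    gen_mat_cancel[OF i(2)]
  \<comment> \<open>Turns \<open>i + 1\<close> into \<open>Suc i\<close>, the form that
    simplification produces in the goals below.\<close>
  note square = square[simplified]
  have f_i: "sends f (gen_mat i) (- (gen_mat i * gen_mat (i + 1) * gen_mat i))"
    "sends f (gen_mat (i + 1)) (gen_mat i)"
    using f(2)[OF i(1)] f(2)[OF i(2)] by (simp_all add: braid_def)
  have g_i: "sends g (gen_mat i) (gen_mat (i + 1))"
    "sends g (gen_mat (i + 1)) (- (gen_mat (i + 1) * gen_mat i * gen_mat (i + 1)))"
    using g(2)[OF i(1)] g(2)[OF i(2)] by (simp_all add: braid_inv_def)
  have "sends (f \<circ> g) (gen_mat j) (gen_mat j)" if j: "j \<in> {1..n - 1}" for j
  proof (rule sends_comp[OF g(2)[OF j]])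
    \<comment> \<open>The image word reduces to \<open>gen_mat (i + 1)\<close>: the square of
      \<open>gen_mat i\<close> occurs at both ends and the signs cancel.\<close>
    have "sends f (- (gen_mat (i + 1) * gen_mat i * gen_mat (i + 1)))
        (- (gen_mat i * - (gen_mat i * gen_mat (i + 1) * gen_mat i) * gen_mat i))"
      by (intro sends_mult sends_uminus f(1) f_i)
    then show "sends f (braid_inv i gen_mat j) (gen_mat j)"
      using f(2)[OF j] f_i(2) by (auto simp: braid_inv_def braid_def mult.assoc square)
  qed
  moreover have "sends (g \<circ> f) (gen_mat j) (gen_mat j)" if j: "j \<in> {1..n - 1}" for j
  proof (rule sends_comp[OF f(2)[OF j]])
    have "sends g (- (gen_mat i * gen_mat (i + 1) * gen_mat i))
        (- (gen_mat (i + 1) * - (gen_mat (i + 1) * gen_mat i * gen_mat (i + 1)) * gen_mat (i + 1)))"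
      by (intro sends_mult sends_uminus g(1) g_i)
    then show "sends g (braid i gen_mat j) (gen_mat j)"
      using g(2)[OF j] g_i(1) by (auto simp: braid_inv_def braid_def mult.assoc square)
  qed
  moreover have "sends id X X" for X
    by (simp add: sends_def mat2.map_id)
  ultimately have inverse:
    "\<And>j. j \<in> {1..n - 1} \<Longrightarrow> \<exists>Y. sends (f \<circ> g) (gen_mat j) Y \<and> sends id (gen_mat j) Y"
    "\<And>j. j \<in> {1..n - 1} \<Longrightarrow> \<exists>Y. sends (g \<circ> f) (gen_mat j) Y \<and> sends id (gen_mat j) Y"
    by blast+
  have "(f \<circ> g) x = id x" "(g \<circ> f) x = id x" if "x \<in> carrier (qalg n q)" for x
    using sends_eqI[OF alg_end_comp[OF g(1) f(1)] id_alg_end inverse(1) that]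
      sends_eqI[OF alg_end_comp[OF f(1) g(1)] id_alg_end inverse(2) that] by simp_all
  then have "bij_betw f (carrier (qalg n q)) (carrier (qalg n q))"
    using alg_end_closed[OF f(1)] alg_end_closed[OF g(1)]
    by (intro bij_betw_byWitness[where f' = g]) auto
  with f(1) show ?thesis
    by (simp add: alg_aut_def)
qed

text \<open>Both composites are evaluated on each matrix as words in \<open>X\<close>,
  \<open>Y\<close>, \<open>Z\<close>; the matrices with other indices are fixed by \<open>f\<close>
  and \<open>g\<close>.\<close>

lemma beta_braid_relation:
  assumes i: "1 \<le> i" "i + 2 \<le> n - 1"
    and "is_beta n q i f" "is_beta n q (i + 1) g" and x: "x \<in> carrier (qalg n q)"
  shows "f (g (f x)) = g (f (g x))"
proof -
  have f: "f \<in> alg_end n q" "\<And>j. j \<in> {1..n - 1} \<Longrightarrow> sends f (gen_mat j) (braid i gen_mat j)"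
    using assms by (auto simp: is_beta_iff)
  have g: "g \<in> alg_end n q" "\<And>j. j \<in> {1..n - 1} \<Longrightarrow> sends g (gen_mat j) (braid (i + 1) gen_mat j)"
    using assms by (auto simp: is_beta_iff)
  define X Y Z where "X = gen_mat i" and "Y = gen_mat (i + 1)" and "Z = gen_mat (i + 2)"
  have X: "X * (X * V) = - V" for V
    unfolding X_def using i by (intro gen_mat_cancel) simp
  have fX: "sends f X (- (X * Y * X))" and fY: "sends f Y X" and fZ: "sends f Z Z"
    and gX: "sends g X X" and gY: "sends g Y (- (Y * Z * Y))" and gZ: "sends g Z Y"
    using f(2)[of i] f(2)[of "i + 1"] f(2)[of "i + 2"] g(2)[of i] g(2)[of "i + 1"] g(2)[of "i + 2"] i
    by (simp_all add: braid_def X_def Y_def Z_def)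
  note act = sends_mult[OF f(1)] sends_mult[OF g(1)] sends_uminus[OF f(1)] sends_uminus[OF g(1)]
    fX fY fZ gX gY gZ
  have "\<exists>W. sends (f \<circ> (g \<circ> f)) (gen_mat j) W \<and> sends (g \<circ> (f \<circ> g)) (gen_mat j) W"
    if j: "j \<in> {1..n - 1}" for j
  proof -
    consider "j = i" | "j = i + 1" | "j = i + 2" | "j \<notin> {i, i + 1, i + 2}"
      by blast
    then show ?thesis
    proof cases
      case 1
      have gfX: "sends g (- (X * Y * X)) (- (X * - (Y * Z * Y) * X))"
        and fgfX: "sends f (- (X * - (Y * Z * Y) * X)) (- ((- (X * Y * X)) * - (X * Z * X) * - (X * Y * X)))"
        by (intro act)+
      have "sends (f \<circ> (g \<circ> f)) X (- ((- (X * Y * X)) * - (X * Z * X) * - (X * Y * X)))"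
        and "sends (g \<circ> (f \<circ> g)) X (- (X * - (Y * Z * Y) * X))"
        by (rule sends_comp[OF sends_comp[OF fX gfX] fgfX] sends_comp[OF sends_comp[OF gX fX] gfX])+
      \<comment> \<open>Cancelling the two inner squares of \<open>X\<close> turns the first word
        into \<open>X * Y * Z * Y * X\<close>, which equals the second one after its signs
        cancel.\<close>
      then show ?thesis
        unfolding 1 X_def[symmetric] by (auto simp: mult.assoc X)
    next
      case 2
      have "sends f (- (Y * Z * Y)) (- (X * Z * X))" "sends g (- (X * Z * X)) (- (X * Y * X))"
        by (intro act)+
      then have "sends (f \<circ> (g \<circ> f)) Y (- (X * Y * X))" "sends (g \<circ> (f \<circ> g)) Y (- (X * Y * X))"
        using sends_comp[OF sends_comp[OF fY gX] fX] sends_comp[OF sends_comp[OF gY]] by blast+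
      then show ?thesis
        unfolding 2 Y_def[symmetric] by blast
    next
      case 3
      have "sends (f \<circ> (g \<circ> f)) Z X" "sends (g \<circ> (f \<circ> g)) Z X"
        using sends_comp[OF sends_comp[OF fZ gZ] fY] sends_comp[OF sends_comp[OF gZ fY] gX] by blast+
      then show ?thesis
        unfolding 3 Z_def[symmetric] by blast
    next
      case 4
      then have "sends f (gen_mat j) (gen_mat j)" "sends g (gen_mat j) (gen_mat j)"
        using f(2)[OF j] g(2)[OF j] by (simp_all add: braid_def)
      then show ?thesis
        by (blast intro: sends_comp)
    qed
  qed
  then have "(f \<circ> (g \<circ> f)) x = (g \<circ> (f \<circ> g)) x"
    using x by (intro sends_eqI alg_end_comp f(1) g(1))
  then show ?thesis
    by simp
qed

end

theorem lemma8:
  fixes n :: nat and h :: real and q :: complex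
  assumes "n \<ge> 3" and "h > 0" and "q = exp (\<i> * complex_of_real (pi * h))"
  shows "(\<forall>i\<in>{1..n - 2}.
            (\<exists>!f. is_beta n q i f) \<and> (\<forall>f. is_beta n q i f \<longrightarrow> f \<in> alg_aut n q)) \<and>
         (\<forall>i\<in>{1..n - 3}. \<forall>f g. is_beta n q i f \<longrightarrow> is_beta n q (i + 1) g \<longrightarrow>
            (\<forall>x\<in>carrier (qalg n q). f (g (f x)) = g (f (g x))))"
proof -
  interpret quantum_algebra n q
    \<comment> \<open>An exponential never vanishes, so \<open>q\<close> is invertible.\<close>
    by standard (simp add: assms(3))
  show ?thesis
  proof (intro conjI ballI allI impI)
    fix i assume "i \<in> {1..n - 2}"
    then have i: "1 \<le> i" "i + 1 \<le> n - 1"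
      using assms(1) by auto
    show "\<exists>!f. is_beta n q i f"
      by (rule ex1_beta[OF i])
    show "f \<in> alg_aut n q" if "is_beta n q i f" for f
      by (rule beta_alg_aut[OF i that])
  next
    fix i f g x
    assume i: "i \<in> {1..n - 3}" and *: "is_beta n q i f" "is_beta n q (i + 1) g" "x \<in> carrier (qalg n q)"
    have "1 \<le> i" "i + 2 \<le> n - 1"
      using i assms(1) by auto
    then show "f (g (f x)) = g (f (g x))"
      using * by (rule beta_braid_relation)
  qed
qed

end
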